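(* Let $\gamma>0$. The optimal sensing precision $\kappa=(\kappa_1,\dots,\kappa_{N_y})$ and observer gain $L$ for an LPV estimator with $\|G_{\bar w\to\epsilon}(s,\rho)\|_2<\gamma$ (for all $\rho\in\mathcal P$) are given by the following convex optimization problem, whose decision variables $Y\in\mathbb R^{N_x\times N_y}$, symmetric $Q\in\mathbb R^{N_z\times N_z}$, symmetric $X\in\mathbb R^{N_x\times N_x}$ and $\beta\in\mathbb R^{N_y}$ do not depend on $\rho$: $$\min_{Y,\;Q>0,\;X>0,\;\beta>0}\ \|\beta\|_p$$ such that, for all $\rho\in\mathcal P$, $$\begin{bmatrix} M_{11}(\rho) & M_{12}(\rho) & Y\\ M_{12}(\rho)^T & -I_{N_d} & 0\\ Y^T & 0 & -\operatorname{diag}(\beta)\end{bmatrix}<0,\qquad \begin{bmatrix} -Q & C_z(\rho)\\ C_z(\rho)^T & -X\end{bmatrix}<0,\qquad \operatorname{trace}(Q)<\gamma^2,$$ where $$M_{11}(\rho)=XA(\rho)+YC_y(\rho)+\big(XA(\rho)+YC_y(\rho)\big)^T,\qquad M_{12}(\rho)=XB_d(\rho)S_d+YD_d(\rho)S_d.$$ The optimal sensing precision is $\kappa_i=\sqrt{\beta_i}$, $i=1,\dots,N_y$, and the observer gain is $L:=X^{-1}Y$.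
   Context: For symmetric matrices, $M>0$ ($M<0$) means positive (negative) definite; for a vector $\beta$, $\beta>0$ is entrywise, $\operatorname{diag}(\beta)$ is the diagonal matrix with entries $\beta_i$, and $\|\beta\|_p$ is its $p$-norm ($1\le p\le\infty$). The linear parameter varying (LPV) system is scheduled on a parameter $\rho$ lying in a convex polytope $\mathcal P\subset\mathbb R^{N_\rho}$. Its state is $x\in\mathbb R^{N_x}$, its measured output is $y\in\mathbb R^{N_y}$ and its output of interest is $z=C_z(\rho)x\in\mathbb R^{N_z}$ ($C_z$ may be constant). The dynamics have a matrix $A(\rho)$ and offset $b(\rho)$, the measurement has a matrix $C_y(\rho)$ and offset $d(\rho)$. A disturbance in $\mathbb R^{N_d}$ enters the dynamics through $B_d(\rho)$ and the measurement through $D_d(\rho)$; sensor noise $n\in\mathbb R^{N_y}$ is added to the measurement. The observer is $$\dot{\hat x}=(A(\rho)+LC_y(\rho))\hat x-Ly+b(\rho)+Ld(\rho),\qquad \hat z=C_z(\rho)\hat x,$$ with constant gain $L\in\mathbb R^{N_x\times N_y}$. The errors $e=x-\hat x$ and $\epsilon=z-\hat z$ satisfy $$\dot e=(A(\rho)+LC_y(\rho))e+(B_{\bar w}(\rho)+LD_{\bar w}(\rho))\bar w,\qquad \epsilon=C_z(\rho)e,$$ where $\bar w$ is the normalized exogenous input (disturbance and sensor noise, $\|\bar w\|_2=1$), $$B_{\bar w}(\rho)=[\,B_d(\rho)S_d\ \ 0\,],\qquad D_{\bar w}(\rho)=[\,D_d(\rho)S_d\ \ S_n\,].$$ The constant matrix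 $S_d$ scales the disturbance and $S_n=\operatorname{diag}(1/\kappa_1,\dots,1/\kappa_{N_y})$ scales the sensor noise, where $\kappa_i:=1/\|n_i\|_2$ is the precision of the $i$-th sensor; $\beta_i:=\kappa_i^2$ and $\beta=(\beta_1,\dots,\beta_{N_y})^T$. The transfer function from $\bar w$ to $\epsilon$ is $$G_{\bar w\to\epsilon}(s,\rho)=C_z(\rho)\big(sI_{N_x}-A(\rho)-LC_y(\rho)\big)^{-1}\big(B_{\bar w}(\rho)+LD_{\bar w}(\rho)\big),$$ and $\|\cdot\|_2$ applied to it is the $\mathcal H_2$ norm. "Optimal sensing precision" means the minimum precision (maximum sensor noise), measured by $\|\beta\|_p$, for which some gain $L$ achieves the stated error bound.
   Formalization: For several parameter values optimality over all gains is false; it is proved among designs certified by a ρ-independent Gramian bound, with an upper bound in general and full optimality for a single ρ. The error bound includes stability; the minimum is read as an infimum. *)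

theory Defs
  imports "HOL-Analysis.Analysis"
begin

definition pos_def :: "real^'n^'n \<Rightarrow> bool" where
  "pos_def M \<longleftrightarrow> transpose M = M \<and> (\<forall>v. v \<noteq> 0 \<longrightarrow> 0 < v \<bullet> (M *v v))"

definition neg_def :: "real^'n^'n \<Rightarrow> bool" where
  "neg_def M \<longleftrightarrow> transpose M = M \<and> (\<forall>v. v \<noteq> 0 \<longrightarrow> v \<bullet> (M *v v) < 0)"

definition diag :: "real^'n \<Rightarrow> real^'n^'n" where
  "diag b = (\<chi> i j. if i = j then b $ i else 0)"

text \<open>Block matrices are indexed by sum types.\<close>

definition hcat :: "'a^'m^'k \<Rightarrow> 'a^'n^'k \<Rightarrow> 'a^('m + 'n)^'k" where
  "hcat M N = (\<chi> i j. case j of Inl a \<Rightarrow> M $ i $ a | Inr b \<Rightarrow> N $ i $ b)"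

definition vcat :: "'a^'k^'m \<Rightarrow> 'a^'k^'n \<Rightarrow> 'a^'k^('m + 'n)" where
  "vcat M N = (\<chi> i. case i of Inl a \<Rightarrow> M $ a | Inr b \<Rightarrow> N $ b)"

definition pnorm :: "ereal \<Rightarrow> real^'n \<Rightarrow> real" where
  "pnorm p b = (if p = \<infinity> then infnorm b
     else (\<Sum>i\<in>UNIV. \<bar>b $ i\<bar> powr real_of_ereal p) powr (1 / real_of_ereal p))"

abbreviation cmat :: "real^'n^'m \<Rightarrow> complex^'n^'m" where
  "cmat \<equiv> map_matrix complex_of_real"

definition hurwitz :: "real^'n^'n \<Rightarrow> bool" where
  "hurwitz M \<longleftrightarrow> (\<forall>s v. v \<noteq> 0 \<and> cmat M *v v = s *s v \<longrightarrow> Re s < 0)"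

definition h2_norm_sq :: "(complex \<Rightarrow> complex^'w^'z) \<Rightarrow> ennreal" where
  "h2_norm_sq G = ennreal (1 / (2 * pi)) *
     (\<integral>\<^sup>+ \<omega>. ennreal (Re (trace (map_matrix cnj (transpose (G (\<i> * complex_of_real \<omega>)))
                                  ** G (\<i> * complex_of_real \<omega>)))) \<partial>lborel)"

text \<open>The frequency-domain \<open>H\<^sub>2\<close> norm, with value \<open>\<infinity>\<close> when the integral diverges. The integral
  alone does not see instability; stability is a separate condition in \<open>h2_performance\<close>.\<close>

definition h2_norm :: "(complex \<Rightarrow> complex^'w^'z) \<Rightarrow> ennreal" where
  "h2_norm G = (if h2_norm_sq G = \<infinity> then \<infinity> else ennreal (sqrt (enn2real (h2_norm_sq G))))"

text \<open>The data on which the estimation error depends. The offsets of the dynamics and of the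
  measurement are absent because they cancel in the error equation.\<close>

record ('r, 'x, 'y, 'z, 'd) lpv =
  Am :: "real^('r::finite) \<Rightarrow> real^('x::finite)^'x"
  Bd :: "real^'r \<Rightarrow> real^('d::finite)^'x"
  Cy :: "real^'r \<Rightarrow> real^'x^('y::finite)"
  Dd :: "real^'r \<Rightarrow> real^'d^'y"
  Cz :: "real^'r \<Rightarrow> real^'x^('z::finite)"
  Sd :: "real^'d^'d"

definition Sn :: "real^'y \<Rightarrow> real^'y^'y" where
  "Sn \<kappa> = diag (\<chi> i. 1 / \<kappa> $ i)"

definition Bw :: "('r::finite, 'x::finite, 'y::finite, 'z::finite, 'd::finite) lpv
    \<Rightarrow> real^'r \<Rightarrow> real^('d + 'y)^'x" where
  "Bw S \<rho> = hcat (Bd S \<rho> ** Sd S) 0"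

definition Dw :: "('r::finite, 'x::finite, 'y::finite, 'z::finite, 'd::finite) lpv
    \<Rightarrow> real^'y \<Rightarrow> real^'r \<Rightarrow> real^('d + 'y)^'y" where
  "Dw S \<kappa> \<rho> = hcat (Dd S \<rho> ** Sd S) (Sn \<kappa>)"

definition err_A :: "('r::finite, 'x::finite, 'y::finite, 'z::finite, 'd::finite) lpv
    \<Rightarrow> real^'y^'x \<Rightarrow> real^'r \<Rightarrow> real^'x^'x" where
  "err_A S L \<rho> = Am S \<rho> + L ** Cy S \<rho>"

definition err_B :: "('r::finite, 'x::finite, 'y::finite, 'z::finite, 'd::finite) lpv
    \<Rightarrow> real^'y \<Rightarrow> real^'y^'x \<Rightarrow> real^'r \<Rightarrow> real^('d + 'y)^'x" where
  "err_B S \<kappa> L \<rho> = Bw S \<rho> + L ** Dw S \<kappa> \<rho>"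

definition transfer_fn :: "('r::finite, 'x::finite, 'y::finite, 'z::finite, 'd::finite) lpv
    \<Rightarrow> real^'y \<Rightarrow> real^'y^'x \<Rightarrow> complex \<Rightarrow> real^'r \<Rightarrow> complex^('d + 'y)^'z" where
  "transfer_fn S \<kappa> L s \<rho> =
     cmat (Cz S \<rho>) ** matrix_inv (mat s - cmat (err_A S L \<rho>)) ** cmat (err_B S \<kappa> L \<rho>)"

definition h2_performance :: "('r::finite, 'x::finite, 'y::finite, 'z::finite, 'd::finite) lpv
    \<Rightarrow> (real^'r) set \<Rightarrow> real \<Rightarrow> real^'y \<Rightarrow> real^'y^'x \<Rightarrow> bool" where
  "h2_performance S P \<gamma> \<kappa> L \<longleftrightarrow>
     (\<forall>\<rho>\<in>P. hurwitz (err_A S L \<rho>) \<and> h2_norm (\<lambda>s. transfer_fn S \<kappa> L s \<rho>) < ennreal \<gamma>)"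

text \<open>The designs (sensor precision, observer gain) that meet the error bound.\<close>

definition h2_designs :: "('r::finite, 'x::finite, 'y::finite, 'z::finite, 'd::finite) lpv
    \<Rightarrow> (real^'r) set \<Rightarrow> real \<Rightarrow> ((real^'y) \<times> (real^'y^'x)) set" where
  "h2_designs S P \<gamma> = {(\<kappa>, L). (\<forall>i. 0 < \<kappa> $ i) \<and> h2_performance S P \<gamma> \<kappa> L}"

text \<open>The designs for which one bound \<open>W\<close> on the controllability Gramians (error covariances) of
  the error system, the same for all parameter values, shows that the error bound is met. For a
  single parameter value every design that meets the bound is of this kind; over a larger parameter
  set this need not be so.\<close>

definition quadratic_h2_designs ::
  "('r::finite, 'x::finite, 'y::finite, 'z::finite, 'd::finite) lpv
    \<Rightarrow> (real^'r) set \<Rightarrow> real \<Rightarrow> ((real^'y) \<times> (real^'y^'x)) set" where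
  "quadratic_h2_designs S P \<gamma> = {(\<kappa>, L). (\<forall>i. 0 < \<kappa> $ i) \<and>
     (\<exists>W Q. pos_def W \<and> trace Q < \<gamma>\<^sup>2 \<and>
       (\<forall>\<rho>\<in>P. neg_def (err_A S L \<rho> ** W + W ** transpose (err_A S L \<rho>)
                          + err_B S \<kappa> L \<rho> ** transpose (err_B S \<kappa> L \<rho>)) \<and>
               pos_def (Q - Cz S \<rho> ** W ** transpose (Cz S \<rho>))))}"

definition M11 :: "('r::finite, 'x::finite, 'y::finite, 'z::finite, 'd::finite) lpv
    \<Rightarrow> real^'x^'x \<Rightarrow> real^'y^'x \<Rightarrow> real^'r \<Rightarrow> real^'x^'x" where
  "M11 S X Y \<rho> = X ** Am S \<rho> + Y ** Cy S \<rho> + transpose (X ** Am S \<rho> + Y ** Cy S \<rho>)"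

definition M12 :: "('r::finite, 'x::finite, 'y::finite, 'z::finite, 'd::finite) lpv
    \<Rightarrow> real^'x^'x \<Rightarrow> real^'y^'x \<Rightarrow> real^'r \<Rightarrow> real^'d^'x" where
  "M12 S X Y \<rho> = X ** Bd S \<rho> ** Sd S + Y ** Dd S \<rho> ** Sd S"

definition lmi1 :: "('r::finite, 'x::finite, 'y::finite, 'z::finite, 'd::finite) lpv
    \<Rightarrow> real^'x^'x \<Rightarrow> real^'y^'x \<Rightarrow> real^'y \<Rightarrow> real^'r
    \<Rightarrow> real^('x + 'd + 'y)^('x + 'd + 'y)" where
  "lmi1 S X Y \<beta> \<rho> =
     vcat (hcat (M11 S X Y \<rho>) (hcat (M12 S X Y \<rho>) Y))
    (vcat (hcat (transpose (M12 S X Y \<rho>)) (hcat (- mat 1) 0))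
          (hcat (transpose Y) (hcat 0 (- diag \<beta>))))"

definition lmi2 :: "('r::finite, 'x::finite, 'y::finite, 'z::finite, 'd::finite) lpv
    \<Rightarrow> real^'z^'z \<Rightarrow> real^'x^'x \<Rightarrow> real^'r \<Rightarrow> real^('z + 'x)^('z + 'x)" where
  "lmi2 S Q X \<rho> = vcat (hcat (- Q) (Cz S \<rho>)) (hcat (transpose (Cz S \<rho>)) (- X))"

definition feasible :: "('r::finite, 'x::finite, 'y::finite, 'z::finite, 'd::finite) lpv
    \<Rightarrow> (real^'r) set \<Rightarrow> real \<Rightarrow> ((real^'y^'x) \<times> (real^'z^'z) \<times> (real^'x^'x) \<times> (real^'y)) set" where
  "feasible S P \<gamma> = {(Y, Q, X, \<beta>). pos_def Q \<and> pos_def X \<and> (\<forall>i. 0 < \<beta> $ i) \<and>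
     (\<forall>\<rho>\<in>P. neg_def (lmi1 S X Y \<beta> \<rho>) \<and> neg_def (lmi2 S Q X \<rho>)) \<and> trace Q < \<gamma>\<^sup>2}"

definition objective :: "ereal \<Rightarrow> (real^'y^'x) \<times> (real^'z^'z) \<times> (real^'x^'x) \<times> (real^'y) \<Rightarrow> real" where
  "objective p = (\<lambda>(Y, Q, X, \<beta>). pnorm p \<beta>)"

definition design_of ::
  "(real^'y^'x) \<times> (real^'z^'z) \<times> (real^'x^'x) \<times> (real^'y) \<Rightarrow> (real^'y) \<times> (real^'y^'x)" where
  "design_of = (\<lambda>(Y, Q, X, \<beta>). (\<chi> i. sqrt (\<beta> $ i), matrix_inv X ** Y))"

definition precision_cost :: "ereal \<Rightarrow> (real^'y) \<times> (real^'y^'x) \<Rightarrow> real" where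
  "precision_cost p = (\<lambda>(\<kappa>, L). pnorm p (\<chi> i. (\<kappa> $ i)\<^sup>2))"

definition argmins :: "('a \<Rightarrow> real) \<Rightarrow> 'a set \<Rightarrow> 'a set" where
  "argmins f D = {d. is_arg_min f (\<lambda>d. d \<in> D) d}"

text \<open>The optimal value is an infimum in the extended reals: the constraints are strict, so it
  need not be attained, and it is \<open>\<infinity>\<close> for an infeasible problem.\<close>

definition opt_value :: "('a \<Rightarrow> real) \<Rightarrow> 'a set \<Rightarrow> ereal" where
  "opt_value f D = (INF d\<in>D. ereal (f d))"

text \<open>Problem \<open>(f, F)\<close> solves the design problem \<open>(c, D)\<close> through the map \<open>\<phi>\<close>: the feasible points
  yield exactly the designs in \<open>D\<close>, at the same cost, and likewise for optima.\<close>

definition solves_via :: "('a \<Rightarrow> 'b) \<Rightarrow> ('a \<Rightarrow> real) \<Rightarrow> 'a set \<Rightarrow> ('b \<Rightarrow> real) \<Rightarrow> 'b set \<Rightarrow> bool" where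
  "solves_via \<phi> f F c D \<longleftrightarrow>
     \<phi> ` F = D \<and> (\<forall>v\<in>F. c (\<phi> v) = f v) \<and>
     \<phi> ` argmins f F = argmins c D \<and> opt_value f F = opt_value c D"

end

theory Submission
  imports Defs "HOL-Complex_Analysis.Cauchy_Integral_Theorem"
begin

text \<open>For one parameter value the theorem rests on the chain
  \<^item> \<open>A\<close> is Hurwitz and the \<open>H\<^sub>2\<close> norm of \<open>C (s - A)\<inverse> B\<close> is below \<open>\<gamma>\<close>;
  \<^item> some positive definite \<open>W\<close> has \<open>A W + W A\<^sup>T + B B\<^sup>T < 0\<close> and \<open>trace (C W C\<^sup>T) < \<gamma>\<^sup>2\<close>;
  \<^item> \<open>X = W\<inverse>\<close>, \<open>Y = X L\<close>, \<open>\<beta> = \<kappa>\<^sup>2\<close> and a slack variable \<open>Q\<close> solve the matrix inequalities.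

The first equivalence is \<open>h2_norm_less_iff_lyapunov_inequality\<close>. The \<open>H\<^sub>2\<close> norm is defined in the
frequency domain, and the proof stays there, without matrix exponentials and without Plancherel's
theorem. If \<open>R = - (A W + W A\<^sup>T)\<close> and \<open>\<Phi> = (i\<omega> - A)\<inverse>\<close>, then \<open>\<Phi> R \<Phi>\<^sup>* = \<Phi> W + W \<Phi>\<^sup>*\<close>, so that
integrals of the quadratic expression on the left reduce to integrals of \<open>\<Phi>\<close> itself. For Hurwitz
\<open>A\<close> the real part of \<open>\<Phi>\<close> has integral \<open>\<pi>\<close> times the identity, by Cauchy's theorem on a half disc
(\<open>resolvent_row_integral\<close>). Hence \<open>\<integral> \<Phi> R \<Phi>\<^sup>* d\<omega> = 2\<pi> W\<close>, and this one formula gives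
everything that is needed about Lyapunov equations: \<open>W\<close> is determined by \<open>R\<close>, so that the equation
is solvable for every right-hand side (\<open>lyapunov_surj\<close>); \<open>W\<close> is positive definite if \<open>R\<close> is
(\<open>lyapunov_solution_pos_def\<close>); and for \<open>R = B B\<^sup>T\<close> the squared \<open>H\<^sub>2\<close> norm is \<open>trace (C W C\<^sup>T)\<close>
(\<open>total_resolvent_energy\<close>). The strict inequalities come from perturbing \<open>R\<close> by a small multiple of
the identity in one direction, and from monotonicity of the integral in \<open>R\<close> in the other.

The second equivalence is linear algebra: Schur complements (\<open>neg_def_schur_complement\<close>) remove the
disturbance and sensor blocks, and congruence with \<open>W = X\<inverse>\<close> turns the remaining inequality into the
Lyapunov inequality of the error system (\<open>neg_def_lmi1_iff\<close>). It holds for each parameter value with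
the same \<open>X\<close>, so the feasible points correspond exactly to the designs with a common Gramian bound
(\<open>design_of_feasible_eq_quadratic_h2_designs\<close>); for a single parameter value these are all designs
that meet the bound. The substitution preserves the cost, hence also the optima, and the problem
is convex because the matrix inequalities are affine in the decision variables and because of
Minkowski's inequality.\<close>

section \<open>The resolvent of a Hurwitz matrix\<close>

definition cvec :: "real^'n \<Rightarrow> complex^'n" where
  "cvec u = (\<chi> i. complex_of_real (u $ i))"

definition Re_vec :: "complex^'n \<Rightarrow> real^'n" where
  "Re_vec p = (\<chi> i. Re (p $ i))"

definition Im_vec :: "complex^'n \<Rightarrow> real^'n" where
  "Im_vec p = (\<chi> i. Im (p $ i))"

text \<open>The transfer matrix is studied one row at a time: \<open>C $ i\<close> times the resolvent. Since the real
  vector \<open>u\<close> multiplies from the left, the equation for the row (\<open>resolvent_row_eq\<close>) involves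
  \<open>A\<^sup>T\<close>, which is what a Gramian \<open>W\<close> in \<open>A W + W A\<^sup>T\<close> calls for.\<close>

definition resolvent_row :: "real^'n^'n \<Rightarrow> real^'n \<Rightarrow> complex \<Rightarrow> complex^'n" where
  "resolvent_row A u s = cvec u v* matrix_inv (mat s - cmat A)"

lemma matrix_inv_mult:
  fixes M :: "'a::field^'n^'n"
  assumes "invertible M"
  shows "M ** matrix_inv M = mat 1" "matrix_inv M ** M = mat 1"
  using assms someI_ex[of "\<lambda>M'. M ** M' = mat 1 \<and> M' ** M = mat 1"]
  unfolding invertible_def matrix_inv_def by auto

lemma mat_mult_vector: "(mat s :: 'a::comm_semiring_1^'n^'n) *v x = s *s x"
  by (simp add: vec_eq_iff matrix_vector_mult_def mat_def if_distrib if_distribR cong: if_cong)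

lemma vector_mult_mat: "x v* (mat s :: 'a::comm_semiring_1^'n^'n) = s *s x"
  by (metis mat_mult_vector transpose_mat transpose_matrix_vector)

lemma norm_vector_smult: "norm (s *s (x :: complex^'n)) = cmod s * norm x"
  by (simp add: norm_vec_def norm_mult L2_set_right_distrib)

lemma hurwitz_invertible:
  assumes "hurwitz A" "0 \<le> Re s"
  shows "invertible (mat s - cmat A)"
proof -
  have "x = 0" if "(mat s - cmat A) *v x = 0" for x
  proof -
    have "cmat A *v x = s *s x"
      using that by (simp add: matrix_vector_mult_diff_rdistrib mat_mult_vector)
    then show ?thesis
      using assms unfolding hurwitz_def by force
  qed
  then show ?thesis
    using matrix_left_invertible_ker invertible_left_inverse by blast
qed

lemma resolvent_row_eq:
  assumes "hurwitz A" "0 \<le> Re s"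
  shows "s *s resolvent_row A u s - resolvent_row A u s v* cmat A = cvec u"
proof -
  have "resolvent_row A u s v* (mat s - cmat A) = cvec u"
    by (simp add: resolvent_row_def vector_matrix_mul_assoc
        matrix_inv_mult[OF hurwitz_invertible[OF assms]])
  then show ?thesis
    by (simp add: vector_matrix_mult_diff_rdistrib vector_mult_mat)
qed

text \<open>By Cramer's rule the entries are quotients of polynomials in \<open>s\<close>, and the denominator has
  no zero in the closed right half-plane.\<close>

lemma resolvent_row_holomorphic:
  fixes A :: "real^'n^'n"
  assumes "hurwitz A"
  shows "(\<lambda>s. resolvent_row A u s $ k) holomorphic_on {s. 0 \<le> Re s}"
proof -
  let ?M = "\<lambda>s. transpose (mat s - cmat A)"
  have det0: "det (?M s) \<noteq> 0" if "0 \<le> Re s" for s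
    using hurwitz_invertible[OF assms that] by (simp only: invertible_det_nz det_transpose not_False_eq_True)
  have "?M s *v resolvent_row A u s = cvec u" if "0 \<le> Re s" for s
    using resolvent_row_eq[OF assms that, of u]
    by (simp add: vector_matrix_mult_diff_rdistrib vector_mult_mat)
  then have eq: "resolvent_row A u s $ k =
      det (\<chi> i j. if j = k then cvec u $ i else ?M s $ i $ j) / det (?M s)"
    if "0 \<le> Re s" for s
    using cramer[OF det0[OF that], of "resolvent_row A u s" "cvec u"] that by simp
  have entry: "(\<lambda>s. ?M s $ i $ j) holomorphic_on {s. 0 \<le> Re s}" for i j
    by (cases "i = j") (auto simp: transpose_def mat_def intro!: holomorphic_intros)
  have "(\<lambda>s. det (\<chi> i j. if j = k then cvec u $ i else ?M s $ i $ j)) holomorphic_on {s. 0 \<le> Re s}"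
    unfolding det_def vec_lambda_beta
    by (intro holomorphic_intros, rename_tac p i, case_tac "p i = k")
       (auto intro!: holomorphic_intros entry)
  moreover have "(\<lambda>s. det (?M s)) holomorphic_on {s. 0 \<le> Re s}"
    unfolding det_def by (intro holomorphic_intros entry)
  ultimately have "(\<lambda>s. det (\<chi> i j. if j = k then cvec u $ i else ?M s $ i $ j) / det (?M s))
      holomorphic_on {s. 0 \<le> Re s}"
    using det0 by (intro holomorphic_intros) auto
  then show ?thesis
    by (rule holomorphic_transform) (use eq in auto)
qed

text \<open>The resolvent behaves like \<open>1 / s\<close> at infinity. Comparing with \<open>1 / (s + 1)\<close> instead still
  leaves an error of order \<open>1 / s\<^sup>2\<close>, and the difference is holomorphic at \<open>s = 0\<close> as well.\<close>

lemma resolvent_row_decay: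
  fixes A :: "real^'n^'n"
  assumes "hurwitz A"
  obtains C where "0 \<le> C" "\<And>s k. 0 \<le> Re s \<Longrightarrow> C \<le> cmod s \<Longrightarrow> 0 < cmod s \<Longrightarrow>
     cmod (resolvent_row A u s $ k - cvec u $ k / (s + 1)) \<le> C / (cmod s)\<^sup>2"
proof -
  have "bounded_linear (\<lambda>p. p v* cmat A)"
    using matrix_vector_mul_bounded_linear[of "transpose (cmat A)"]
    unfolding transpose_matrix_vector[abs_def] .
  then obtain K where K: "K \<ge> 0" "\<And>p. norm (p v* cmat A) \<le> norm p * K"
    using bounded_linear.nonneg_bounded by blast
  define C where "C = 2 * K + (K + 1) * 2 * norm (cvec u)"
  have "0 \<le> C"
    using K(1) by (simp add: C_def)
  moreover have "cmod (resolvent_row A u s $ k - cvec u $ k / (s + 1)) \<le> C / (cmod s)\<^sup>2"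
    if s: "0 \<le> Re s" "C \<le> cmod s" "0 < cmod s" for s k
  proof -
    define p where "p = resolvent_row A u s"
    have eq: "s *s p - p v* cmat A = cvec u"
      unfolding p_def by (rule resolvent_row_eq[OF assms s(1)])
    \<comment> \<open>From here on \<open>s\<close> dominates \<open>A\<close>, so that \<open>s p = u + p A\<close> forces \<open>p\<close> to be of order \<open>1 / s\<close>.\<close>
    have K2: "2 * K \<le> cmod s"
      using s(2) K(1) unfolding C_def
      by (smt (verit) mult_nonneg_nonneg norm_ge_zero)
    have "cmod s * norm p = norm (cvec u + p v* cmat A)"
      by (simp add: eq[symmetric] norm_vector_smult)
    also have "\<dots> \<le> norm (cvec u) + norm p * K"
      using norm_triangle_ineq K(2) by (smt (verit))
    also have "norm p * K \<le> norm p * (cmod s / 2)"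
      using K2 by (intro mult_left_mono) auto
    finally have p: "norm p \<le> 2 * norm (cvec u) / cmod s"
      using s(3) by (simp add: field_simps)
    have s1: "cmod s \<le> cmod (s + 1)"
      using s(1) unfolding cmod_def by (intro real_sqrt_le_mono) (simp add: power2_eq_square algebra_simps)
    then have nz: "s + 1 \<noteq> 0"
      using s(3) by auto
    have "(s + 1) * p $ k - cvec u $ k = (p v* cmat A + p) $ k"
      by (simp add: eq[symmetric] algebra_simps)
    then have "p $ k - cvec u $ k / (s + 1) = (p v* cmat A + p) $ k / (s + 1)"
      using nz by (simp add: field_simps)
    then have "cmod (p $ k - cvec u $ k / (s + 1)) = cmod ((p v* cmat A + p) $ k) / cmod (s + 1)"
      by (simp add: norm_divide)
    also have "\<dots> \<le> norm (p v* cmat A + p) / cmod s"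
      using s1 s(3) by (intro frac_le Finite_Cartesian_Product.norm_nth_le) auto
    also have "norm (p v* cmat A + p) \<le> (K + 1) * norm p"
      using norm_triangle_ineq[of "p v* cmat A" p] K(2)[of p] by (simp add: algebra_simps)
    also have "\<dots> \<le> (K + 1) * (2 * norm (cvec u) / cmod s)"
      using p K(1) by (intro mult_left_mono) auto
    also have "\<dots> = (C - 2 * K) / cmod s"
      by (simp add: C_def)
    also have "\<dots> \<le> C / cmod s"
      using K(1) s(3) by (intro divide_right_mono) auto
    finally show ?thesis
      using s(3) by (simp add: p_def power2_eq_square divide_right_mono)
  qed
  ultimately show ?thesis
    using that by blast
qed

section \<open>The integral of the resolvent along the imaginary axis\<close>

lemma continuous_on_resolvent_row:
  assumes "hurwitz A"
  shows "continuous_on UNIV (\<lambda>\<omega>. resolvent_row A u (\<i> * complex_of_real \<omega>) $ k)"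
proof -
  have "continuous_on {s. 0 \<le> Re s} (\<lambda>s. resolvent_row A u s $ k)"
    by (intro holomorphic_on_imp_continuous_on resolvent_row_holomorphic assms)
  then show ?thesis
    by (rule continuous_on_compose2) (auto intro!: continuous_intros)
qed

text \<open>The difference \<open>h\<close> is holomorphic on the closed right half-plane, so its integral over the
  segment from \<open>-iT\<close> to \<open>iT\<close> equals the one over the right half of the circle of radius \<open>T\<close>,
  where \<open>h\<close> is \<open>O(1 / T\<^sup>2)\<close> on a path of length \<open>\<pi> T\<close>.\<close>

lemma resolvent_row_correction_bound:
  fixes A :: "real^'n^'n" and u :: "real^'n"
  assumes "hurwitz A"
  defines "h \<equiv> (\<lambda>k s. resolvent_row A u s $ k - cvec u $ k / (s + 1))"
  obtains C where "0 \<le> C"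
    "\<And>T k. 0 < T \<Longrightarrow> C \<le> T \<Longrightarrow>
       cmod (integral {-T..T} (\<lambda>\<omega>. h k (\<i> * complex_of_real \<omega>))) \<le> C * pi / T"
proof -
  let ?H = "{s. 0 \<le> Re s}"
  obtain C where C: "0 \<le> C" "\<And>s k. 0 \<le> Re s \<Longrightarrow> C \<le> cmod s \<Longrightarrow> 0 < cmod s \<Longrightarrow>
      cmod (h k s) \<le> C / (cmod s)\<^sup>2"
    unfolding h_def by (rule resolvent_row_decay[OF assms(1), of u]) blast
  have hol: "h k holomorphic_on ?H" for k
    unfolding h_def
    by (intro holomorphic_intros resolvent_row_holomorphic assms) (auto simp: complex_eq_iff)
  then have cont: "continuous_on ?H (h k)" for k
    by (rule holomorphic_on_imp_continuous_on)
  have "cmod (integral {-T..T} (\<lambda>\<omega>. h k (\<i> * complex_of_real \<omega>))) \<le> C * pi / T"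
    if T: "0 < T" "C \<le> T" for T k
  proof -
    define up where "up = linepath (Complex 0 (-T)) (Complex 0 T)"
    define arc where "arc = part_circlepath 0 T (-pi/2) (pi/2)"
    have arc_ends: "pathstart arc = Complex 0 (-T)" "pathfinish arc = Complex 0 T"
      by (auto simp: arc_def exp_eq_polar cis_conv_exp[symmetric] complex_eq_iff)
    have arc_H: "path_image arc \<subseteq> ?H"
      unfolding arc_def path_image_part_circlepath'
      by (auto simp: closed_segment_eq_real_ivl T less_imp_le intro!: mult_nonneg_nonneg cos_ge_zero)
    have arc_cmod: "cmod s = T" if "s \<in> path_image arc" for s
      using that T unfolding arc_def path_image_part_circlepath' by (auto simp: norm_mult)
    have up_H: "path_image up \<subseteq> ?H"
    proof -
      have "convex ?H"
        by (rule convex_halfspace_Re_ge)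
      then show ?thesis
        unfolding up_def by (simp add: closed_segment_subset)
    qed
    have valid: "valid_path up" "valid_path arc"
      by (simp_all add: up_def arc_def)
    have int: "h k contour_integrable_on up" "h k contour_integrable_on arc"
      unfolding up_def arc_def using up_H arc_H
      by (auto intro!: contour_integrable_continuous_linepath
          contour_integrable_continuous_part_circlepath continuous_on_subset[OF cont]
          simp: up_def arc_def)
    have "(h k has_contour_integral 0) (arc +++ reversepath up)"
      by (rule Cauchy_theorem_convex_simple[OF hol convex_halfspace_Re_ge])
         (use arc_ends arc_H up_H in \<open>auto simp: path_image_join up_def arc_def
            closed_segment_commute[of "Complex 0 T"] intro!: valid_path_join\<close>)
    then have "contour_integral (arc +++ reversepath up) (h k) = 0"
      by (rule contour_integral_unique)
    then have "contour_integral arc (h k) = contour_integral up (h k)"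
      using int valid by (simp add: contour_integral_reversepath contour_integrable_reversepath)
    also have "\<dots> = \<i> * integral {-T..T} (\<lambda>x. h k (Complex 0 x))"
      unfolding up_def using T by (intro contour_integral_linepath_same_Re) auto
    finally have "cmod (integral {-T..T} (\<lambda>x. h k (Complex 0 x))) = cmod (contour_integral arc (h k))"
      by (simp add: norm_mult)
    also have "\<dots> \<le> C / T\<^sup>2 * T * \<bar>pi/2 - (-pi/2)\<bar>"
      unfolding arc_def
    proof (rule contour_integral_bound_part_circlepath)
      show "cmod (h k x) \<le> C / T\<^sup>2" if "x \<in> path_image (part_circlepath 0 T (- pi / 2) (pi / 2))" for x
        using C(2)[of x k] arc_H arc_cmod[of x] that T by (auto simp: arc_def)
    qed (use int C T in \<open>auto simp: arc_def\<close>)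
    also have "\<dots> = C * pi / T"
      using T by (simp add: power2_eq_square)
    finally show ?thesis
      by (simp add: Complex_eq)
  qed
  then show ?thesis
    using that C(1) by blast
qed

lemma integral_Re_inverse_shift:
  assumes "0 \<le> T"
  shows "((\<lambda>\<omega>. Re (complex_of_real c / (\<i> * complex_of_real \<omega> + 1))) has_integral
           c * (2 * arctan T)) {-T..T}"
proof -
  have "((\<lambda>\<omega>. c * inverse (1 + \<omega>\<^sup>2)) has_integral (c * arctan T - c * arctan (-T))) {-T..T}"
    using assms
    by (intro fundamental_theorem_of_calculus)
       (auto simp flip: has_real_derivative_iff_has_vector_derivative intro!: derivative_eq_intros)
  moreover have "Re (complex_of_real c / (\<i> * complex_of_real \<omega> + 1)) = c * inverse (1 + \<omega>\<^sup>2)" for \<omega>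
    by (simp add: Re_divide divide_inverse)
  ultimately show ?thesis
    by (simp add: arctan_minus mult.left_commute)
qed

lemma resolvent_row_component_integral:
  fixes A :: "real^'n^'n"
  assumes "hurwitz A"
  shows "(\<lambda>n. integral {- real n..real n} (\<lambda>\<omega>. Re (resolvent_row A u (\<i> * complex_of_real \<omega>) $ k)))
           \<longlonglongrightarrow> pi * u $ k"
proof -
  define h where "h = (\<lambda>s. resolvent_row A u s $ k - cvec u $ k / (s + 1))"
  let ?I = "\<lambda>n::nat. integral {- real n..real n} (\<lambda>\<omega>. h (\<i> * complex_of_real \<omega>))"
  obtain C where C: "0 \<le> C"
    "\<And>T. 0 < T \<Longrightarrow> C \<le> T \<Longrightarrow>
       cmod (integral {-T..T} (\<lambda>\<omega>. h (\<i> * complex_of_real \<omega>))) \<le> C * pi / T"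
    unfolding h_def by (rule resolvent_row_correction_bound[OF assms, of u]) blast
  have "?I \<longlonglongrightarrow> 0"
  proof (rule Lim_null_comparison)
    show "\<forall>\<^sub>F n in sequentially. cmod (?I n) \<le> C * pi / real n"
    proof (rule eventually_sequentiallyI)
      fix n assume "nat \<lceil>C\<rceil> + 1 \<le> n"
      then show "cmod (?I n) \<le> C * pi / real n"
        by (intro C(2)) linarith+
    qed
  qed (rule lim_const_over_n)
  then have "(\<lambda>n. Re (?I n)) \<longlonglongrightarrow> 0"
    using tendsto_Re by fastforce
  moreover have "(\<lambda>n. u $ k * (2 * arctan (real n))) \<longlonglongrightarrow> u $ k * (2 * (pi / 2))"
    by (intro tendsto_intros filterlim_compose[OF tendsto_arctan_at_top filterlim_real_sequentially])
  ultimately have "(\<lambda>n. Re (?I n) + u $ k * (2 * arctan (real n))) \<longlonglongrightarrow> 0 + u $ k * (2 * (pi / 2))"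
    by (rule tendsto_add)
  moreover have "integral {- real n..real n} (\<lambda>\<omega>. Re (resolvent_row A u (\<i> * complex_of_real \<omega>) $ k)) =
      Re (?I n) + u $ k * (2 * arctan (real n))" for n
  proof -
    let ?S = "{- real n..real n}"
    have "continuous_on ?S (\<lambda>\<omega>. h (\<i> * complex_of_real \<omega>))"
      unfolding h_def
      by (intro continuous_intros continuous_on_subset[OF continuous_on_resolvent_row[OF assms]])
         (auto simp: complex_eq_iff)
    then have "((\<lambda>\<omega>. h (\<i> * complex_of_real \<omega>)) has_integral ?I n) ?S"
      by (intro integrable_integral integrable_continuous_real)
    then have "((\<lambda>\<omega>. Re (h (\<i> * complex_of_real \<omega>))) has_integral Re (?I n)) ?S"
      by (rule has_integral_Re)
    from has_integral_add[OF this integral_Re_inverse_shift[of "real n" "u $ k"]]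
    show ?thesis
      by (intro integral_unique) (simp add: h_def cvec_def)
  qed
  ultimately show ?thesis
    by (simp add: mult.commute)
qed

lemma continuous_on_inner_Re_resolvent_row:
  fixes A :: "real^'n^'n"
  assumes "hurwitz A"
  shows "continuous_on S (\<lambda>\<omega>. c \<bullet> Re_vec (resolvent_row A u (\<i> * complex_of_real \<omega>)))"
  unfolding inner_vec_def Re_vec_def
  by (auto intro!: continuous_intros continuous_on_subset[OF continuous_on_resolvent_row[OF assms]])

text \<open>The resolvent itself decays too slowly to be integrable along the imaginary axis, but its real
  part is integrable. The limit does not depend on \<open>A\<close>, because the comparison function
  \<open>u / (s + 1)\<close> carries the whole integral.\<close>

lemma resolvent_row_integral:
  fixes A :: "real^'n^'n"
  assumes "hurwitz A"
  shows "(\<lambda>n. integral {- real n..real n}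
            (\<lambda>\<omega>. c \<bullet> Re_vec (resolvent_row A u (\<i> * complex_of_real \<omega>)))) \<longlonglongrightarrow> pi * (c \<bullet> u)"
proof -
  have "integral {- real n..real n} (\<lambda>\<omega>. c \<bullet> Re_vec (resolvent_row A u (\<i> * complex_of_real \<omega>))) =
     (\<Sum>k\<in>UNIV. c $ k * integral {- real n..real n}
         (\<lambda>\<omega>. Re (resolvent_row A u (\<i> * complex_of_real \<omega>) $ k)))" for n
  proof -
    have "(\<lambda>\<omega>. c $ k * Re (resolvent_row A u (\<i> * complex_of_real \<omega>) $ k))
        integrable_on {- real n..real n}" for k
      by (intro integrable_continuous_real continuous_intros
          continuous_on_subset[OF continuous_on_resolvent_row[OF assms]]) auto
    then show ?thesis
      by (simp add: inner_vec_def Re_vec_def integral_sum)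
  qed
  moreover have "(\<lambda>n. \<Sum>k\<in>UNIV. c $ k * integral {- real n..real n}
         (\<lambda>\<omega>. Re (resolvent_row A u (\<i> * complex_of_real \<omega>) $ k))) \<longlonglongrightarrow>
      (\<Sum>k\<in>UNIV. c $ k * (pi * u $ k))"
    by (intro tendsto_intros resolvent_row_component_integral assms)
  moreover have "(\<Sum>k\<in>UNIV. c $ k * (pi * u $ k)) = pi * (c \<bullet> u)"
    by (simp add: inner_vec_def sum_distrib_left mult_ac)
  ultimately show ?thesis
    by simp
qed

lemma nn_integral_eq_limit_of_symmetric_integrals:
  fixes f :: "real \<Rightarrow> real"
  assumes f: "continuous_on UNIV f" "\<And>x. 0 \<le> f x"
    and lim: "(\<lambda>n. integral {- real n..real n} f) \<longlonglongrightarrow> I"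
  shows "(\<integral>\<^sup>+ x. ennreal (f x) \<partial>lborel) = ennreal I"
proof -
  have [measurable]: "f \<in> borel_measurable borel"
    by (rule borel_measurable_continuous_onI[OF f(1)])
  let ?F = "\<lambda>n x. ennreal (f x) * indicator {- real n..real n} x"
  have "(\<lambda>n. \<integral>\<^sup>+ x. ?F n x \<partial>lborel) \<longlonglongrightarrow> (\<integral>\<^sup>+ x. ennreal (f x) \<partial>lborel)"
  proof (rule nn_integral_LIMSEQ)
    show "incseq ?F"
      by (auto simp: incseq_def le_fun_def indicator_def)
    show "(\<lambda>n. ?F n x) \<longlonglongrightarrow> ennreal (f x)" for x
    proof (rule tendsto_eventually, rule eventually_sequentiallyI)
      fix n assume "nat \<lceil>\<bar>x\<bar>\<rceil> \<le> n"
      then have "\<bar>x\<bar> \<le> real n"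
        by linarith
      then show "?F n x = ennreal (f x)"
        by (auto simp: indicator_def)
    qed
  qed measurable
  moreover have "(\<integral>\<^sup>+ x. ?F n x \<partial>lborel) = ennreal (integral {- real n..real n} f)" for n
    by (intro nn_integral_has_integral_lebesgue' f integrable_integral integrable_continuous_real
        continuous_on_subset[OF f(1)]) auto
  ultimately show ?thesis
    using tendsto_ennrealI[OF lim] LIMSEQ_unique by simp
qed

section \<open>Lyapunov equations and Gramians\<close>

text \<open>For Hurwitz \<open>A\<close>, the solution \<open>W\<close> of \<open>lyapunov A W = - R\<close> is the stationary covariance of the
  state under white noise of covariance \<open>R\<close>.\<close>

definition lyapunov :: "real^'n^'n \<Rightarrow> real^'n^'n \<Rightarrow> real^'n^'n" where
  "lyapunov A W = A ** W + W ** transpose A"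

lemma dot_matrix_mult: "x \<bullet> ((M ** N) *v y) = (x v* M) \<bullet> (N *v (y :: real^'n))"
  by (simp add: dot_lmul_matrix flip: matrix_vector_mul_assoc)

lemma dot_symmetric_matrix:
  fixes W :: "real^'n^'n"
  assumes "transpose W = W"
  shows "x \<bullet> (W *v y) = y \<bullet> (W *v x)"
  by (metis assms dot_lmul_matrix inner_commute transpose_matrix_vector)

lemma dot_lyapunov: "x \<bullet> (lyapunov A W *v y) = (x v* A) \<bullet> (W *v y) + x \<bullet> (W *v (y v* A))"
  by (simp add: lyapunov_def matrix_vector_mult_add_rdistrib inner_add_right dot_matrix_mult dot_lmul_matrix
     flip: matrix_vector_mul_assoc)

lemma Re_vec_mult_cmat: "Re_vec (p v* cmat (A :: real^'n^'m)) = Re_vec p v* A"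
  by (simp add: Re_vec_def vec_eq_iff vector_matrix_mult_def)

lemma Im_vec_mult_cmat: "Im_vec (p v* cmat (A :: real^'n^'m)) = Im_vec p v* A"
  by (simp add: Im_vec_def vec_eq_iff vector_matrix_mult_def)

text \<open>Real and imaginary part of the equation \<open>p (i\<omega> - A) = u\<close>.\<close>

lemma resolvent_row_real_equations:
  fixes A :: "real^'n^'n" and u :: "real^'n"
  assumes "hurwitz A"
  defines "p \<equiv> \<lambda>\<omega>. resolvent_row A u (\<i> * complex_of_real \<omega>)"
  shows "Re_vec (p \<omega>) v* A = - (\<omega> *\<^sub>R Im_vec (p \<omega>)) - u" "Im_vec (p \<omega>) v* A = \<omega> *\<^sub>R Re_vec (p \<omega>)"
proof -
  have "p \<omega> v* cmat A = (\<i> * complex_of_real \<omega>) *s p \<omega> - cvec u"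
    using resolvent_row_eq[OF assms(1), of "\<i> * complex_of_real \<omega>" u]
    unfolding p_def by (simp add: algebra_simps)
  then show "Re_vec (p \<omega>) v* A = - (\<omega> *\<^sub>R Im_vec (p \<omega>)) - u" "Im_vec (p \<omega>) v* A = \<omega> *\<^sub>R Re_vec (p \<omega>)"
    unfolding Re_vec_mult_cmat[symmetric] Im_vec_mult_cmat[symmetric]
    by (simp_all add: Re_vec_def Im_vec_def vec_eq_iff cvec_def)
qed

text \<open>This is \<open>\<Phi> R \<Phi>\<^sup>* = \<Phi> W + W \<Phi>\<^sup>*\<close> for \<open>R = - (A W + W A\<^sup>T)\<close>, read between \<open>u\<close> and \<open>v\<close>, in real
  terms: the contributions of \<open>i\<omega>\<close> and \<open>-i\<omega>\<close> cancel, and what is left is linear in the resolvent.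
  The bilinear form is needed because \<open>W\<close> is not known to be symmetric at this point.\<close>

lemma resolvent_row_lyapunov:
  fixes A W :: "real^'n^'n" and \<omega> :: real
  assumes "hurwitz A"
  defines "p \<equiv> \<lambda>u. resolvent_row A u (\<i> * complex_of_real \<omega>)"
  shows "Re_vec (p u) \<bullet> (lyapunov A W *v Re_vec (p v)) + Im_vec (p u) \<bullet> (lyapunov A W *v Im_vec (p v))
     = - ((u v* W) \<bullet> Re_vec (p v)) - (W *v v) \<bullet> Re_vec (p u)"
  unfolding dot_lyapunov p_def resolvent_row_real_equations[OF assms(1)]
  by (simp add: matrix_vector_mult_diff_distrib matrix_vector_mult_scaleR vector_matrix_mult_diff_distrib
    inner_diff_left inner_diff_right inner_commute dot_lmul_matrix
    linear_neg[OF matrix_vector_mul_linear])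

lemma lyapunov_bilinear_integral:
  fixes A W :: "real^'n^'n"
  assumes "hurwitz A"
  shows "(\<lambda>n. integral {- real n..real n} (\<lambda>\<omega>.
      (u v* W) \<bullet> Re_vec (resolvent_row A v (\<i> * complex_of_real \<omega>))
      + (W *v v) \<bullet> Re_vec (resolvent_row A u (\<i> * complex_of_real \<omega>))))
    \<longlonglongrightarrow> 2 * pi * (u \<bullet> (W *v v))"
proof -
  have "integral {- real n..real n} (\<lambda>\<omega>.
      (u v* W) \<bullet> Re_vec (resolvent_row A v (\<i> * complex_of_real \<omega>))
      + (W *v v) \<bullet> Re_vec (resolvent_row A u (\<i> * complex_of_real \<omega>))) =
     integral {- real n..real n} (\<lambda>\<omega>. (u v* W) \<bullet> Re_vec (resolvent_row A v (\<i> * complex_of_real \<omega>)))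
      + integral {- real n..real n} (\<lambda>\<omega>. (W *v v) \<bullet> Re_vec (resolvent_row A u (\<i> * complex_of_real \<omega>)))" for n
    by (intro Henstock_Kurzweil_Integration.integral_add integrable_continuous_real
        continuous_on_inner_Re_resolvent_row assms)
  moreover have "2 * pi * (u \<bullet> (W *v v)) = pi * ((u v* W) \<bullet> v) + pi * ((W *v v) \<bullet> u)"
    by (simp add: dot_lmul_matrix inner_commute[of "W *v v"])
  ultimately show ?thesis
    using tendsto_add[OF resolvent_row_integral[OF assms, of "u v* W" v]
        resolvent_row_integral[OF assms, of "W *v v" u]]
    by (simp only:)
qed

text \<open>If \<open>A W + W A\<^sup>T\<close> vanishes then so does the integrand whose integral is \<open>2\<pi> u \<bullet> W v\<close>.\<close>

lemma lyapunov_inj: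
  fixes A :: "real^'n^'n"
  assumes "hurwitz A" "lyapunov A W = 0"
  shows "W = 0"
proof -
  have "u \<bullet> (W *v v) = 0" for u v
  proof -
    have "(u v* W) \<bullet> Re_vec (resolvent_row A v (\<i> * complex_of_real \<omega>))
      + (W *v v) \<bullet> Re_vec (resolvent_row A u (\<i> * complex_of_real \<omega>)) = 0" for \<omega>
      using resolvent_row_lyapunov[OF assms(1), of u \<omega> W v] assms(2) by simp
    then show ?thesis
      using lyapunov_bilinear_integral[OF assms(1), of u W v] LIMSEQ_unique[OF tendsto_const] by fastforce
  qed
  then show ?thesis
    by (metis inner_eq_zero_iff matrix_eq matrix_vector_mult_0)
qed

lemma linear_lyapunov: "linear (lyapunov (A :: real^'n^'n))"
  by (rule linearI)
     (simp_all add: lyapunov_def vec_eq_iff matrix_matrix_mult_def algebra_simps sum.distrib sum_distrib_left)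

text \<open>An injective linear map of a finite-dimensional space into itself is onto; this replaces the
  usual construction of the Gramian as an integral of matrix exponentials.\<close>

lemma lyapunov_surj:
  fixes A :: "real^'n^'n"
  assumes "hurwitz A"
  obtains W where "lyapunov A W = R"
proof -
  have "inj (lyapunov A)"
    using lyapunov_inj[OF assms] by (simp add: linear_injective_0[OF linear_lyapunov])
  then show ?thesis
    using linear_injective_imp_surjective[OF linear_lyapunov] that by (metis surjD)
qed

lemma transpose_add: "transpose (M + N) = transpose M + transpose (N :: real^'n^'m)"
  by (simp add: transpose_def vec_eq_iff)

lemma transpose_minus: "transpose (- M) = - transpose (M :: real^'n^'m)"
  by (simp add: transpose_def vec_eq_iff)

lemma transpose_diff: "transpose (M - N) = transpose M - transpose (N :: real^'n^'m)"
  by (simp add: transpose_def vec_eq_iff)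

lemma transpose_lyapunov: "transpose (lyapunov A W) = lyapunov A (transpose W)"
  by (simp add: lyapunov_def transpose_add matrix_transpose_mul add.commute)

lemma lyapunov_solution_symmetric:
  assumes "hurwitz A" "lyapunov A W = R" "transpose R = R"
  shows "transpose W = W"
proof -
  have "lyapunov A (transpose W - W) = 0"
    using assms(2,3) by (simp add: linear_diff[OF linear_lyapunov] flip: transpose_lyapunov)
  then show ?thesis
    using lyapunov_inj[OF assms(1)] by fastforce
qed

text \<open>The Hermitian form \<open>p R p\<^sup>*\<close> at \<open>p = u (i\<omega> - A)\<inverse>\<close>; for symmetric \<open>R\<close> it splits into the real
  and the imaginary part of \<open>p\<close>.\<close>

definition resolvent_energy :: "real^'n^'n \<Rightarrow> real^'n^'n \<Rightarrow> real^'n \<Rightarrow> real \<Rightarrow> real" where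
  "resolvent_energy A R u \<omega> =
     (let p = resolvent_row A u (\<i> * complex_of_real \<omega>)
      in Re_vec p \<bullet> (R *v Re_vec p) + Im_vec p \<bullet> (R *v Im_vec p))"

lemma resolvent_energy_nonneg:
  "(\<And>x. 0 \<le> x \<bullet> (R *v x)) \<Longrightarrow> 0 \<le> resolvent_energy A R u \<omega>"
  by (simp add: resolvent_energy_def Let_def)

lemma resolvent_energy_mono:
  "(\<And>x. x \<bullet> (R *v x) \<le> x \<bullet> (R' *v x)) \<Longrightarrow> resolvent_energy A R u \<omega> \<le> resolvent_energy A R' u \<omega>"
  by (simp add: resolvent_energy_def Let_def add_mono)

lemma resolvent_energy_pos:
  assumes "hurwitz A" "\<And>x. x \<noteq> 0 \<Longrightarrow> 0 < x \<bullet> (R *v x)" "u \<noteq> 0"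
  shows "0 < resolvent_energy A R u \<omega>"
proof -
  let ?p = "resolvent_row A u (\<i> * complex_of_real \<omega>)"
  have "Re_vec ?p \<noteq> 0 \<or> Im_vec ?p \<noteq> 0"
    using resolvent_row_real_equations(1)[OF assms(1), of u \<omega>] assms(3) by auto
  moreover have "0 \<le> x \<bullet> (R *v x)" for x
    using assms(2)[of x] by (cases "x = 0") auto
  ultimately show ?thesis
    unfolding resolvent_energy_def Let_def using assms(2) by (metis add_nonneg_pos add_pos_nonneg)
qed

lemma continuous_on_resolvent_energy:
  assumes "hurwitz A"
  shows "continuous_on UNIV (resolvent_energy A R u)"
  unfolding resolvent_energy_def[abs_def] Let_def inner_vec_def matrix_vector_mult_def
    Re_vec_def Im_vec_def vec_lambda_beta
  by (intro continuous_intros continuous_on_resolvent_row assms)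

lemma matrix_uminus_vector: "(- M) *v x = - (M *v (x :: real^'n))"
  by (simp add: matrix_vector_mult_def vec_eq_iff sum_negf)

lemma resolvent_energy_integral:
  fixes A W R :: "real^'n^'n"
  assumes "hurwitz A" "lyapunov A W = - R"
  shows "(\<lambda>n. integral {- real n..real n} (resolvent_energy A R u)) \<longlonglongrightarrow> 2 * pi * (u \<bullet> (W *v u))"
proof -
  have "resolvent_energy A R u \<omega> =
      (u v* W) \<bullet> Re_vec (resolvent_row A u (\<i> * complex_of_real \<omega>))
      + (W *v u) \<bullet> Re_vec (resolvent_row A u (\<i> * complex_of_real \<omega>))" for \<omega>
    using resolvent_row_lyapunov[OF assms(1), of u \<omega> W u]
    by (simp add: resolvent_energy_def Let_def assms(2) matrix_uminus_vector)
  then show ?thesis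
    using lyapunov_bilinear_integral[OF assms(1), of u W u] by presburger
qed

text \<open>The integrand is nonnegative, so by monotone convergence the limit over growing intervals is the
  Lebesgue integral that the definition of the \<open>H\<^sub>2\<close> norm asks for.\<close>

lemma resolvent_energy_nn_integral:
  fixes A W R :: "real^'n^'n"
  assumes "hurwitz A" "lyapunov A W = - R" "\<And>x. 0 \<le> x \<bullet> (R *v x)"
  shows "(\<integral>\<^sup>+ \<omega>. ennreal (resolvent_energy A R u \<omega>) \<partial>lborel) = ennreal (2 * pi * (u \<bullet> (W *v u)))"
  by (intro nn_integral_eq_limit_of_symmetric_integrals continuous_on_resolvent_energy
      resolvent_energy_nonneg resolvent_energy_integral assms)

lemma lyapunov_solution_nonneg:
  fixes A W R :: "real^'n^'n"
  assumes "hurwitz A" "lyapunov A W = - R" "\<And>x. 0 \<le> x \<bullet> (R *v x)"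
  shows "0 \<le> u \<bullet> (W *v u)"
proof -
  have "0 \<le> 2 * pi * (u \<bullet> (W *v u))"
    by (rule LIMSEQ_le_const[OF resolvent_energy_integral[OF assms(1,2)]])
       (auto intro!: exI Henstock_Kurzweil_Integration.integral_nonneg resolvent_energy_nonneg assms
          integrable_continuous_real continuous_on_subset[OF continuous_on_resolvent_energy])
  then show ?thesis
    using pi_gt_zero by (auto simp: zero_le_mult_iff)
qed

text \<open>The integral of a function that is positive everywhere is not zero.\<close>

lemma lyapunov_solution_pos_def:
  fixes A W R :: "real^'n^'n"
  assumes "hurwitz A" "lyapunov A W = - R" "pos_def R"
  shows "pos_def W"
  unfolding pos_def_def
proof (intro conjI allI impI)
  have R: "transpose R = R" "\<And>x. x \<noteq> 0 \<Longrightarrow> 0 < x \<bullet> (R *v x)" "\<And>x. 0 \<le> x \<bullet> (R *v x)"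
    using assms(3) unfolding pos_def_def by (auto, metis inner_zero_left less_eq_real_def)
  show "transpose W = W"
    by (rule lyapunov_solution_symmetric[OF assms(1,2)]) (simp add: transpose_minus R)
  fix u :: "real^'n" assume u: "u \<noteq> 0"
  let ?f = "resolvent_energy A R u"
  have pos: "0 < ?f \<omega>" for \<omega>
    by (rule resolvent_energy_pos[OF assms(1) R(2) u])
  have [measurable]: "?f \<in> borel_measurable borel"
    by (intro borel_measurable_continuous_onI continuous_on_resolvent_energy assms)
  have "(\<integral>\<^sup>+ \<omega>. ennreal (?f \<omega>) \<partial>lborel) \<noteq> 0"
  proof
    assume "(\<integral>\<^sup>+ \<omega>. ennreal (?f \<omega>) \<partial>lborel) = 0"
    then have "AE \<omega> in lborel. ennreal (?f \<omega>) = 0"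
      by (subst (asm) nn_integral_0_iff_AE) auto
    then have "AE \<omega> in (lborel :: real measure). False"
      using pos by (auto simp: ennreal_eq_0_iff not_le[symmetric])
    then show False
      using ae_filter_eq_bot_iff[of "lborel :: real measure"] by (simp only: eventually_False) simp
  qed
  then show "0 < u \<bullet> (W *v u)"
    unfolding resolvent_energy_nn_integral[OF assms(1,2) R(3)]
    by (auto simp: ennreal_eq_0_iff not_le zero_less_mult_iff)
qed

section \<open>The \<open>H\<^sub>2\<close> norm and Lyapunov inequalities\<close>

lemma dot_gram: "x \<bullet> ((B ** transpose B) *v x) = (norm (x v* B))\<^sup>2" for x :: "real^'n"
  by (simp add: power2_norm_eq_inner dot_matrix_mult)

lemma sum_cmod_sq: "(\<Sum>j\<in>UNIV. (cmod (q $ j))\<^sup>2) = (norm (Re_vec q))\<^sup>2 + (norm (Im_vec q))\<^sup>2"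
  by (simp add: norm_vec_def L2_set_def sum_nonneg Re_vec_def Im_vec_def cmod_power2 sum.distrib)

text \<open>The rows of the transfer matrix are resolvent rows, which makes its squared Frobenius norm a
  sum of resolvent energies with weight \<open>B B\<^sup>T\<close>.\<close>

lemma transfer_matrix_row:
  "(cmat C ** matrix_inv (mat s - cmat A) ** cmat B) $ i = resolvent_row A (C $ i) s v* cmat B"
  by (simp add: vec_eq_iff resolvent_row_def cvec_def matrix_matrix_mult_def vector_matrix_mult_def mult.commute)

lemma Re_trace_gram:
  "Re (trace (map_matrix cnj (transpose G) ** G)) = (\<Sum>i\<in>UNIV. \<Sum>j\<in>UNIV. (cmod (G $ i $ j))\<^sup>2)"
  for G :: "complex^'w^'z"
proof -
  have "Re (cnj z * z) = (cmod z)\<^sup>2" for z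
    unfolding cmod_power2 by (simp add: power2_eq_square)
  then show ?thesis
    unfolding trace_def
    by (simp add: matrix_matrix_mult_def transpose_def)
       (rule sum.swap)
qed

lemma h2_norm_sq_resolvent_energy:
  fixes A :: "real^'n^'n" and B :: "real^'w^'n" and C :: "real^'n^'z"
  shows "h2_norm_sq (\<lambda>s. cmat C ** matrix_inv (mat s - cmat A) ** cmat B) = ennreal (1 / (2 * pi)) *
     (\<integral>\<^sup>+ \<omega>. ennreal (\<Sum>i\<in>UNIV. resolvent_energy A (B ** transpose B) (C $ i) \<omega>) \<partial>lborel)"
  unfolding h2_norm_sq_def Re_trace_gram sum_cmod_sq transfer_matrix_row
  by (simp add: resolvent_energy_def Let_def dot_gram Re_vec_mult_cmat Im_vec_mult_cmat)

lemma trace_congruence: "trace (C ** W ** transpose C) = (\<Sum>i\<in>UNIV. C $ i \<bullet> (W *v C $ i))"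
  for C :: "real^'n^'z"
  by (simp add: trace_def matrix_matrix_mult_def transpose_def matrix_vector_mult_def inner_vec_def
      sum_distrib_left sum_distrib_right)
     (rule sum.cong[OF refl], subst sum.swap, simp add: mult_ac)

text \<open>For \<open>R = B B\<^sup>T\<close> this says that the squared \<open>H\<^sub>2\<close> norm is \<open>trace (C W C\<^sup>T)\<close> for the
  controllability Gramian \<open>W\<close>. General \<open>R\<close> serves for Gramian bounds, which solve a Lyapunov
  inequality only.\<close>

lemma total_resolvent_energy:
  fixes A W R :: "real^'n^'n" and C :: "real^'n^'z"
  assumes "hurwitz A" "lyapunov A W = - R" "\<And>x. 0 \<le> x \<bullet> (R *v x)"
  shows "ennreal (1 / (2 * pi)) * (\<integral>\<^sup>+ \<omega>. ennreal (\<Sum>i\<in>UNIV. resolvent_energy A R (C $ i) \<omega>) \<partial>lborel)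
     = ennreal (trace (C ** W ** transpose C))"
proof -
  have [measurable]: "resolvent_energy A R u \<in> borel_measurable borel" for u
    by (intro borel_measurable_continuous_onI continuous_on_resolvent_energy assms)
  have row: "(\<integral>\<^sup>+ \<omega>. ennreal (resolvent_energy A R u \<omega>) \<partial>lborel) = ennreal (2 * pi * (u \<bullet> (W *v u)))" for u
    by (rule resolvent_energy_nn_integral[OF assms])
  have W: "0 \<le> u \<bullet> (W *v u)" for u
    by (rule lyapunov_solution_nonneg[OF assms])
  have "(\<integral>\<^sup>+ \<omega>. ennreal (\<Sum>i\<in>UNIV. resolvent_energy A R (C $ i) \<omega>) \<partial>lborel) =
      (\<integral>\<^sup>+ \<omega>. (\<Sum>i\<in>UNIV. ennreal (resolvent_energy A R (C $ i) \<omega>)) \<partial>lborel)"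
    by (simp add: sum_ennreal resolvent_energy_nonneg assms(3))
  also have "\<dots> = (\<Sum>i\<in>UNIV. ennreal (2 * pi * (C $ i \<bullet> (W *v C $ i))))"
    by (subst nn_integral_sum) (simp_all add: row)
  also have "\<dots> = ennreal (2 * pi * trace (C ** W ** transpose C))"
    by (simp add: sum_ennreal W trace_congruence sum_distrib_left)
  finally show ?thesis
    by (simp flip: ennreal_mult')
qed

lemma h2_norm_less_iff:
  assumes "0 < \<gamma>"
  shows "h2_norm G < ennreal \<gamma> \<longleftrightarrow> h2_norm_sq G < ennreal (\<gamma>\<^sup>2)"
proof (cases "h2_norm_sq G")
  case (real r)
  then have "h2_norm G < ennreal \<gamma> \<longleftrightarrow> sqrt r < \<gamma>"
    using assms by (simp add: h2_norm_def ennreal_less_iff)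
  also have "\<dots> \<longleftrightarrow> r < \<gamma>\<^sup>2"
    using assms real real_sqrt_less_iff[of r "\<gamma>\<^sup>2"] by simp
  finally show ?thesis
    using real by (simp add: ennreal_less_iff)
next
  case top
  then show ?thesis by (simp add: h2_norm_def)
qed

lemma pos_def_imp_invertible:
  assumes "pos_def W"
  shows "invertible W"
proof -
  have "x = 0" if "W *v x = 0" for x
    using assms that unfolding pos_def_def by (metis inner_zero_right less_irrefl)
  then show ?thesis
    using invertible_left_inverse matrix_left_invertible_ker by blast
qed

text \<open>The classical argument evaluates the form of \<open>W\<inverse> A + A\<^sup>T W\<inverse>\<close> at an eigenvector \<open>v\<close> of \<open>A\<close>.
  Here the eigenvector is written as \<open>v = W (y + iz)\<close>, so that the inequality for \<open>A W + W A\<^sup>T\<close>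
  applies to \<open>y\<close> and \<open>z\<close> directly; in the sum of the two forms the imaginary part of the
  eigenvalue drops out by symmetry of \<open>W\<close>.\<close>

lemma neg_def_lyapunov_imp_hurwitz:
  fixes A W :: "real^'n^'n"
  assumes W: "pos_def W" and L: "\<And>y. y \<noteq> 0 \<Longrightarrow> y \<bullet> (lyapunov A W *v y) < 0"
  shows "hurwitz A"
  unfolding hurwitz_def
proof (intro allI impI, elim conjE)
  fix s :: complex and v :: "complex^'n"
  assume v: "v \<noteq> 0" and ev: "cmat A *v v = s *s v"
  define y where "y = matrix_inv W *v Re_vec v"
  define z where "z = matrix_inv W *v Im_vec v"
  have a: "Re_vec v = W *v y" and b: "Im_vec v = W *v z"
    unfolding y_def z_def
    by (simp_all add: matrix_vector_mul_assoc matrix_inv_mult[OF pos_def_imp_invertible[OF W]])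
  have nz: "y \<noteq> 0 \<or> z \<noteq> 0"
  proof (rule ccontr)
    assume "\<not> (y \<noteq> 0 \<or> z \<noteq> 0)"
    then have "Re_vec v = 0" "Im_vec v = 0"
      by (auto simp: a b)
    then show False
      using v by (auto simp: vec_eq_iff Re_vec_def Im_vec_def complex_eq_iff)
  qed
  have "Re_vec (cmat A *v v) = A *v Re_vec v" "Im_vec (cmat A *v v) = A *v Im_vec v"
    by (simp_all add: Re_vec_def Im_vec_def vec_eq_iff matrix_vector_mult_def)
  then have Aa: "A *v (W *v y) = Re s *\<^sub>R (W *v y) - Im s *\<^sub>R (W *v z)"
    and Ab: "A *v (W *v z) = Re s *\<^sub>R (W *v z) + Im s *\<^sub>R (W *v y)"
    unfolding ev a[symmetric] b[symmetric]
    by (simp_all add: Re_vec_def Im_vec_def vec_eq_iff)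
  have sym: "transpose W = W"
    using W by (simp add: pos_def_def)
  have quad: "x \<bullet> (lyapunov A W *v x) = 2 * (x \<bullet> (A *v (W *v x)))" for x
    unfolding dot_lyapunov dot_symmetric_matrix[OF sym, of x] by (simp add: dot_lmul_matrix)
  have pd: "0 < x \<bullet> (W *v x)" if "x \<noteq> 0" for x
    using W that by (simp add: pos_def_def)
  have pd0: "0 \<le> x \<bullet> (W *v x)" for x
    using pd[of x] by (cases "x = 0") auto
  have L0: "x \<bullet> (lyapunov A W *v x) \<le> 0" for x
    using L[of x] by (cases "x = 0") auto
  have "y \<bullet> (lyapunov A W *v y) + z \<bullet> (lyapunov A W *v z) = 2 * Re s * (y \<bullet> (W *v y) + z \<bullet> (W *v z))"
    unfolding quad Aa Ab
    by (simp add: inner_diff_right inner_add_right dot_symmetric_matrix[OF sym, of z y] algebra_simps)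
  moreover have "y \<bullet> (lyapunov A W *v y) + z \<bullet> (lyapunov A W *v z) < 0"
    using nz L L0 by (metis add_neg_nonpos add_nonpos_neg)
  moreover have "0 \<le> y \<bullet> (W *v y) + z \<bullet> (W *v z)"
    using pd0 by simp
  ultimately show "Re s < 0"
    by (smt (verit) mult_nonneg_nonneg)
qed

lemma trace_pos_def_nonneg: "pos_def M \<Longrightarrow> 0 \<le> trace M"
proof -
  assume M: "pos_def M"
  have "M $ i $ i = axis i 1 \<bullet> (M *v axis i 1)" for i
    by (simp add: inner_axis' matrix_vector_mult_basis column_def)
  then have "0 < M $ i $ i" for i
    using M by (simp add: pos_def_def axis_eq_0_iff)
  then show ?thesis
    by (simp add: trace_def sum_nonneg less_imp_le)
qed

lemma trace_scaleR: "trace (c *\<^sub>R M) = c * trace (M :: real^'n^'n)"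
  by (simp add: trace_def sum_distrib_left)

lemma pos_def_scaled_identity: "0 < \<epsilon> \<Longrightarrow> pos_def (\<epsilon> *\<^sub>R mat 1 :: real^'n^'n)"
  by (simp add: pos_def_def transpose_scalar scaleR_matrix_vector_assoc[symmetric])

lemma matrix_add_rdistrib: "(M + N) ** K = M ** K + N ** (K :: real^'k^'n)"
  by (simp add: matrix_matrix_mult_def vec_eq_iff distrib_right sum.distrib)

text \<open>From left to right, \<open>W\<close> is the Gramian \<open>W0\<close> of the system plus a small multiple of the Gramian
  \<open>W1\<close> for unit noise covariance: this makes both \<open>W\<close> and the Lyapunov inequality strictly definite,
  and the strict bound on the norm leaves room for it. From right to left, \<open>W\<close> is the exact Gramian
  for a covariance \<open>R'\<close> that dominates \<open>B B\<^sup>T\<close>.\<close>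

lemma h2_norm_less_iff_lyapunov_inequality:
  fixes A :: "real^'n^'n" and B :: "real^'w^'n" and C :: "real^'n^'z"
  assumes "0 < \<gamma>"
  shows "hurwitz A \<and> h2_norm (\<lambda>s. cmat C ** matrix_inv (mat s - cmat A) ** cmat B) < ennreal \<gamma> \<longleftrightarrow>
     (\<exists>W Q. pos_def W \<and> trace Q < \<gamma>\<^sup>2 \<and> neg_def (A ** W + W ** transpose A + B ** transpose B) \<and>
        pos_def (Q - C ** W ** transpose C))"
    (is "?performance \<longleftrightarrow> ?inequality")
proof -
  let ?R = "B ** transpose B"
  have gram: "transpose ?R = ?R" "\<And>x. 0 \<le> x \<bullet> (?R *v x)"
    by (simp_all add: matrix_transpose_mul dot_gram)
  show ?thesis
  proof
    assume ?performance
    then have A: "hurwitz A"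
      and h2: "h2_norm_sq (\<lambda>s. cmat C ** matrix_inv (mat s - cmat A) ** cmat B) < ennreal (\<gamma>\<^sup>2)"
      using h2_norm_less_iff[OF assms] by auto
    obtain W0 where W0: "lyapunov A W0 = - ?R"
      using lyapunov_surj[OF A] by blast
    obtain W1 where W1: "lyapunov A W1 = - mat 1"
      using lyapunov_surj[OF A] by blast
    define t0 where "t0 = trace (C ** W0 ** transpose C)"
    define t1 where "t1 = trace (C ** W1 ** transpose C)"
    have "ennreal t0 < ennreal (\<gamma>\<^sup>2)"
      using h2 unfolding h2_norm_sq_resolvent_energy total_resolvent_energy[OF A W0 gram(2)] t0_def .
    then have t0: "t0 < \<gamma>\<^sup>2"
      using ennreal_leI not_le by metis
    \<comment> \<open>With this \<open>\<epsilon>\<close> the perturbation \<open>\<epsilon> (t1 + CARD('z))\<close> of the trace uses at most half of the gap.\<close>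
    define K where "K = \<bar>t1\<bar> + real CARD('z) + 1"
    define \<epsilon> where "\<epsilon> = (\<gamma>\<^sup>2 - t0) / (2 * K)"
    have K: "0 < K" "t1 + real CARD('z) \<le> K"
      unfolding K_def by auto
    have \<epsilon>: "0 < \<epsilon>"
      using K t0 by (simp add: \<epsilon>_def)
    define W where "W = W0 + \<epsilon> *\<^sub>R W1"
    define Q where "Q = C ** W ** transpose C + \<epsilon> *\<^sub>R mat 1"
    have LW: "lyapunov A W = - (?R + \<epsilon> *\<^sub>R mat 1)"
      unfolding W_def by (simp add: linear_add[OF linear_lyapunov] linear_scale[OF linear_lyapunov] W0 W1)
    have "pos_def (?R + \<epsilon> *\<^sub>R mat 1)"
      using pos_def_scaled_identity[OF \<epsilon>, where 'n='n] gram unfolding pos_def_def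
      by (simp add: transpose_add matrix_vector_mult_add_rdistrib inner_add_right add_nonneg_pos)
    then have "pos_def W"
      by (rule lyapunov_solution_pos_def[OF A LW])
    moreover have "trace Q < \<gamma>\<^sup>2"
    proof -
      have "C ** W ** transpose C = C ** W0 ** transpose C + \<epsilon> *\<^sub>R (C ** W1 ** transpose C)"
        unfolding W_def
        by (simp add: matrix_add_ldistrib matrix_add_rdistrib matrix_scalar_ac flip: scalar_matrix_assoc)
      then have "trace Q = t0 + \<epsilon> * (t1 + real CARD('z))"
        by (simp add: Q_def trace_add trace_scaleR trace_I t0_def t1_def algebra_simps)
      also have "\<dots> \<le> t0 + \<epsilon> * K"
        using K \<epsilon> by simp
      also have "\<epsilon> * K = (\<gamma>\<^sup>2 - t0) / 2"
        using K by (simp add: \<epsilon>_def)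
      finally show ?thesis
        using t0 by (simp add: field_simps)
    qed
    moreover have "neg_def (A ** W + W ** transpose A + ?R)"
    proof -
      have "A ** W + W ** transpose A + ?R = - (\<epsilon> *\<^sub>R mat 1)"
        using LW by (simp add: lyapunov_def)
      then show ?thesis
        using pos_def_scaled_identity[OF \<epsilon>, where 'n='n]
        by (simp add: neg_def_def pos_def_def transpose_minus matrix_uminus_vector)
    qed
    moreover have "pos_def (Q - C ** W ** transpose C)"
      using pos_def_scaled_identity[OF \<epsilon>] by (simp add: Q_def)
    ultimately show ?inequality
      by blast
  next
    assume ?inequality
    then obtain W Q where W: "pos_def W" and Q: "trace Q < \<gamma>\<^sup>2"
      and neg: "neg_def (lyapunov A W + ?R)" and QW: "pos_def (Q - C ** W ** transpose C)"
      unfolding lyapunov_def by blast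
    have lt: "x \<bullet> (lyapunov A W *v x) + x \<bullet> (?R *v x) < 0" if "x \<noteq> 0" for x
      using neg that unfolding neg_def_def by (simp add: matrix_vector_mult_add_rdistrib inner_add_right)
    then have "x \<bullet> (lyapunov A W *v x) < 0" if "x \<noteq> 0" for x
      using gram(2)[of x] that by fastforce
    then have A: "hurwitz A"
      by (rule neg_def_lyapunov_imp_hurwitz[OF W])
    define R' where "R' = - lyapunov A W"
    have le: "x \<bullet> (?R *v x) \<le> x \<bullet> (R' *v x)" for x
      using lt[of x] by (cases "x = 0") (auto simp: R'_def matrix_uminus_vector)
    have R': "lyapunov A W = - R'" "\<And>x. 0 \<le> x \<bullet> (R' *v x)"
      using order_trans[OF gram(2) le] by (simp_all add: R'_def)
    have "h2_norm_sq (\<lambda>s. cmat C ** matrix_inv (mat s - cmat A) ** cmat B)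
        \<le> ennreal (1 / (2 * pi)) * (\<integral>\<^sup>+ \<omega>. ennreal (\<Sum>i\<in>UNIV. resolvent_energy A R' (C $ i) \<omega>) \<partial>lborel)"
      unfolding h2_norm_sq_resolvent_energy
      by (intro mult_left_mono nn_integral_mono ennreal_leI sum_mono resolvent_energy_mono le) simp
    also have "\<dots> = ennreal (trace (C ** W ** transpose C))"
      by (rule total_resolvent_energy[OF A R'])
    also have "\<dots> < ennreal (\<gamma>\<^sup>2)"
      using trace_pos_def_nonneg[OF QW] Q assms by (intro ennreal_lessI) (auto simp: trace_sub)
    finally show ?performance
      using A h2_norm_less_iff[OF assms] by blast
  qed
qed

section \<open>Block matrices and Schur complements\<close>

text \<open>The vector analogue of \<open>vcat\<close>: every vector over a sum type is of this form, which lets block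
  matrices act on blocks.\<close>

definition vjoin :: "'a^'m \<Rightarrow> 'a^'n \<Rightarrow> 'a^('m + 'n)" where
  "vjoin a b = (\<chi> i. case i of Inl k \<Rightarrow> a $ k | Inr k \<Rightarrow> b $ k)"

lemma vjoin_cases:
  obtains a b where "v = vjoin a b"
proof
  show "v = vjoin (\<chi> i. v $ Inl i) (\<chi> i. v $ Inr i)"
    by (simp add: vjoin_def vec_eq_iff split: sum.split)
qed

lemma all_sum_type: "(\<forall>i. Q i) \<longleftrightarrow> (\<forall>k. Q (Inl k)) \<and> (\<forall>k. Q (Inr k))"
  by (metis sum.exhaust)

lemma vjoin_eq_0_iff [simp]: "vjoin a b = 0 \<longleftrightarrow> a = 0 \<and> b = 0"
  by (simp add: vjoin_def vec_eq_iff all_sum_type)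

lemma sum_UNIV_sum_type:
  "(\<Sum>i\<in>UNIV. f i) = (\<Sum>k\<in>UNIV. f (Inl k)) + (\<Sum>k\<in>UNIV. f (Inr k))"
  for f :: "'m::finite + 'n::finite \<Rightarrow> 'b::comm_monoid_add"
  by (simp add: sum.Plus comp_def flip: UNIV_Plus_UNIV)

lemma inner_vjoin [simp]: "vjoin a b \<bullet> vjoin c d = a \<bullet> c + b \<bullet> (d :: real^'n)"
  by (simp add: inner_vec_def sum_UNIV_sum_type vjoin_def)

lemma vcat_mult_vector [simp]: "vcat M N *v v = vjoin (M *v v) (N *v v)"
  by (simp add: vec_eq_iff vcat_def vjoin_def matrix_vector_mult_def split: sum.split)

lemma hcat_mult_vector [simp]: "hcat M N *v vjoin a b = M *v a + N *v b"
  by (simp add: vec_eq_iff hcat_def vjoin_def matrix_vector_mult_def sum_UNIV_sum_type)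

lemma transpose_vcat [simp]: "transpose (vcat M N) = hcat (transpose M) (transpose N)"
  by (simp add: vec_eq_iff hcat_def vcat_def transpose_def split: sum.split)

lemma transpose_hcat [simp]: "transpose (hcat M N) = vcat (transpose M) (transpose N)"
  by (simp add: vec_eq_iff hcat_def vcat_def transpose_def split: sum.split)

lemma hcat_vcat_interchange: "hcat (vcat M N) (vcat K L) = vcat (hcat M K) (hcat N L)"
  by (simp add: vec_eq_iff hcat_def vcat_def split: sum.split)

lemma vcat_eq_iff: "vcat M N = vcat M' N' \<longleftrightarrow> M = M' \<and> N = N'"
  by (simp add: vec_eq_iff vcat_def all_sum_type)

lemma hcat_eq_iff: "hcat M N = hcat M' N' \<longleftrightarrow> M = M' \<and> N = N'"
  by (auto simp add: vec_eq_iff hcat_def all_sum_type)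

lemma uminus_vcat: "- vcat M N = vcat (- M) (- N)"
  by (simp add: vec_eq_iff vcat_def split: sum.split)

lemma uminus_hcat: "- hcat M N = hcat (- M) (- N)"
  by (simp add: vec_eq_iff hcat_def split: sum.split)

lemma mult_hcat: "L ** hcat M N = hcat (L ** M) (L ** N)"
  by (simp add: vec_eq_iff hcat_def matrix_matrix_mult_def split: sum.split)

lemma add_hcat: "hcat M N + hcat M' N' = hcat (M + M') (N + N')"
  by (simp add: vec_eq_iff hcat_def split: sum.split)

lemma hcat_gram: "hcat M N ** transpose (hcat M N) = M ** transpose M + N ** transpose N"
  by (simp add: vec_eq_iff hcat_def matrix_matrix_mult_def transpose_def sum_UNIV_sum_type)

lemma matrix_inv_unique:
  fixes M N :: "'a::field^'n^'n"
  assumes "M ** N = mat 1"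
  shows "matrix_inv M = N"
proof -
  have "invertible M"
    using assms invertible_right_inverse by blast
  then have "matrix_inv M ** (M ** N) = N"
    by (simp add: matrix_mul_assoc matrix_inv_mult)
  then show ?thesis
    by (simp add: assms)
qed

lemma matrix_inv_matrix_inv:
  fixes M :: "'a::field^'n^'n"
  shows "invertible M \<Longrightarrow> matrix_inv (matrix_inv M) = M"
  by (rule matrix_inv_unique) (simp add: matrix_inv_mult)

lemma transpose_matrix_inv:
  fixes M :: "real^'n^'n"
  assumes "invertible M"
  shows "transpose (matrix_inv M) = matrix_inv (transpose M)"
proof -
  have "transpose M ** transpose (matrix_inv M) = mat 1"
    by (simp add: matrix_inv_mult[OF assms] flip: matrix_transpose_mul)
  then show ?thesis
    by (simp add: matrix_inv_unique)
qed

lemma pos_def_matrix_inv: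
  assumes "pos_def X"
  shows "pos_def (matrix_inv X)"
  unfolding pos_def_def
proof (intro conjI allI impI)
  note inv = pos_def_imp_invertible[OF assms]
  show "transpose (matrix_inv X) = matrix_inv X"
    using assms by (simp add: transpose_matrix_inv[OF inv] pos_def_def)
  fix v :: "real^'a" assume v: "v \<noteq> 0"
  let ?w = "matrix_inv X *v v"
  have Xw: "X *v ?w = v"
    by (simp add: matrix_vector_mul_assoc matrix_inv_mult[OF inv])
  then have "?w \<noteq> 0"
    using v by auto
  then have "0 < ?w \<bullet> (X *v ?w)"
    using assms by (simp add: pos_def_def)
  then show "0 < v \<bullet> ?w"
    by (simp add: Xw inner_commute)
qed

lemma neg_def_iff_pos_def_uminus: "neg_def M \<longleftrightarrow> pos_def (- M)"
  by (simp add: neg_def_def pos_def_def transpose_minus matrix_uminus_vector)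

text \<open>Completing the square: the form of the block matrix at \<open>(a, b)\<close> is the form of the Schur
  complement at \<open>a\<close> minus that of \<open>D\<close> at \<open>b - D\<inverse> N\<^sup>T a\<close>.\<close>

lemma neg_def_schur_complement:
  fixes M :: "real^'m^'m" and N :: "real^'n^'m" and D :: "real^'n^'n"
  assumes D: "pos_def D"
  shows "neg_def (vcat (hcat M N) (hcat (transpose N) (- D))) \<longleftrightarrow>
    neg_def (M + N ** matrix_inv D ** transpose N)"
proof -
  let ?B = "vcat (hcat M N) (hcat (transpose N) (- D))"
  let ?S = "M + N ** matrix_inv D ** transpose N"
  let ?b = "\<lambda>a. matrix_inv D *v (transpose N *v a)"
  have symD: "transpose D = D" "transpose (matrix_inv D) = matrix_inv D"
    using D pos_def_matrix_inv[OF D] by (simp_all add: pos_def_def)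
  have sym: "transpose ?B = ?B \<longleftrightarrow> transpose ?S = ?S"
    by (simp add: hcat_vcat_interchange vcat_eq_iff hcat_eq_iff transpose_minus transpose_add
        matrix_transpose_mul symD matrix_mul_assoc)
  have square: "vjoin a b \<bullet> (?B *v vjoin a b) = a \<bullet> (?S *v a) - (b - ?b a) \<bullet> (D *v (b - ?b a))" for a b
  proof -
    have Db: "D *v ?b a = transpose N *v a"
      by (simp add: matrix_vector_mul_assoc matrix_mul_assoc matrix_inv_mult[OF pos_def_imp_invertible[OF D]]
          del: transpose_matrix_vector)
    have Nb: "b \<bullet> (transpose N *v a) = a \<bullet> (N *v b)" for b
      by (metis dot_lmul_matrix inner_commute transpose_matrix_vector)
    have "?b a \<bullet> (D *v b) = b \<bullet> (D *v ?b a)"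
      by (rule dot_symmetric_matrix[OF symD(1)])
    then show ?thesis
      by (simp add: Db Nb inner_add_right inner_diff_left inner_diff_right inner_minus_right
          matrix_vector_mult_add_rdistrib matrix_vector_mult_diff_distrib matrix_uminus_vector
          del: transpose_matrix_vector flip: matrix_vector_mul_assoc)
  qed
  have D0: "0 \<le> c \<bullet> (D *v c)" for c
    using D unfolding pos_def_def by (cases "c = 0") (auto intro: less_imp_le)
  have "(\<forall>v. v \<noteq> 0 \<longrightarrow> v \<bullet> (?B *v v) < 0) \<longleftrightarrow> (\<forall>a. a \<noteq> 0 \<longrightarrow> a \<bullet> (?S *v a) < 0)"
  proof (intro iffI allI impI)
    fix a :: "real^'m" assume neg: "\<forall>v. v \<noteq> 0 \<longrightarrow> v \<bullet> (?B *v v) < 0" and "a \<noteq> 0"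
    then have "vjoin a (?b a) \<bullet> (?B *v vjoin a (?b a)) < 0"
      by (simp only: vjoin_eq_0_iff simp_thms)
    then show "a \<bullet> (?S *v a) < 0"
      unfolding square by simp
  next
    fix v :: "real^('m + 'n)" assume neg: "\<forall>a. a \<noteq> 0 \<longrightarrow> a \<bullet> (?S *v a) < 0" and v: "v \<noteq> 0"
    obtain a b where ab: "v = vjoin a b"
      by (rule vjoin_cases)
    show "v \<bullet> (?B *v v) < 0"
    proof (cases "a = 0")
      case True
      then have "0 < b \<bullet> (D *v b)"
        using v D by (simp add: ab pos_def_def)
      then show ?thesis
        unfolding ab square using True by simp
    next
      case False
      then have "a \<bullet> (?S *v a) < 0"
        using neg by blast
      then show ?thesis
        unfolding ab square using D0[of "b - ?b a"] by linarith
    qed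
  qed
  then show ?thesis
    unfolding neg_def_def sym by simp
qed

lemma pos_def_block_diagonal:
  assumes "pos_def D" "pos_def E"
  shows "pos_def (vcat (hcat D 0) (hcat 0 E))"
  unfolding pos_def_def
proof (intro conjI allI impI)
  have zero: "transpose (0 :: real^'k^'l) = 0"
    by (simp add: transpose_def vec_eq_iff)
  show "transpose (vcat (hcat D 0) (hcat 0 E)) = vcat (hcat D 0) (hcat 0 E)"
    using assms by (simp add: hcat_vcat_interchange pos_def_def zero)
  fix v :: "real^('a + 'b)" assume v: "v \<noteq> 0"
  obtain a b where ab: "v = vjoin a b"
    by (rule vjoin_cases)
  have "0 \<le> a \<bullet> (D *v a)" "0 \<le> b \<bullet> (E *v b)" "a \<noteq> 0 \<Longrightarrow> 0 < a \<bullet> (D *v a)" "b \<noteq> 0 \<Longrightarrow> 0 < b \<bullet> (E *v b)"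
    using assms unfolding pos_def_def by (cases "a = 0"; cases "b = 0"; auto intro: less_imp_le)+
  then show "0 < v \<bullet> (vcat (hcat D 0) (hcat 0 E) *v v)"
    using v by (cases "a = 0") (auto simp: ab add_pos_nonneg)
qed

lemma matrix_inv_block_diagonal:
  fixes D :: "real^'m^'m" and E :: "real^'n^'n"
  assumes "invertible D" "invertible E"
  shows "matrix_inv (vcat (hcat D 0) (hcat 0 E)) = vcat (hcat (matrix_inv D) 0) (hcat 0 (matrix_inv E))"
proof (rule matrix_inv_unique, subst matrix_eq, rule allI)
  fix v :: "real^('m + 'n)"
  obtain a b where ab: "v = vjoin a b"
    by (rule vjoin_cases)
  show "(vcat (hcat D 0) (hcat 0 E) ** vcat (hcat (matrix_inv D) 0) (hcat 0 (matrix_inv E))) *v v = mat 1 *v v"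
    unfolding ab matrix_vector_mul_assoc[symmetric]
    by (simp add: matrix_vector_mul_assoc matrix_inv_mult[OF assms(1)] matrix_inv_mult[OF assms(2)])
qed

lemma hcat_block_diagonal_congruence:
  "hcat M N ** vcat (hcat D 0) (hcat 0 E) ** transpose (hcat M N)
    = M ** D ** transpose M + N ** E ** transpose (N :: real^'n^'k)"
  unfolding matrix_eq
  by (simp add: matrix_vector_mult_add_rdistrib del: transpose_matrix_vector flip: matrix_vector_mul_assoc)

lemma neg_def_congruence:
  fixes M W :: "real^'n^'n"
  assumes "invertible W"
  shows "neg_def (transpose W ** M ** W) \<longleftrightarrow> neg_def M"
proof -
  have *: "neg_def (transpose V ** T ** V)" if T: "neg_def T" and V: "invertible V" for T V :: "real^'n^'n"
    unfolding neg_def_def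
  proof (intro conjI allI impI)
    show "transpose (transpose V ** T ** V) = transpose V ** T ** V"
      using T by (simp add: matrix_transpose_mul matrix_mul_assoc neg_def_def)
    fix v :: "real^'n" assume v: "v \<noteq> 0"
    have "V *v v \<noteq> 0"
    proof
      assume "V *v v = 0"
      then have "matrix_inv V *v (V *v v) = 0"
        by simp
      then show False
        using v by (simp add: matrix_vector_mul_assoc matrix_inv_mult[OF V])
    qed
    then have "(V *v v) \<bullet> (T *v (V *v v)) < 0"
      using T by (simp add: neg_def_def)
    moreover have "v \<bullet> ((transpose V ** T ** V) *v v) = (V *v v) \<bullet> (T *v (V *v v))"
      unfolding matrix_vector_mul_assoc[symmetric] transpose_matrix_vector
      by (metis dot_lmul_matrix inner_commute)
    ultimately show "v \<bullet> ((transpose V ** T ** V) *v v) < 0"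
      by simp
  qed
  have inv: "invertible (matrix_inv W)"
    using matrix_inv_mult(1)[OF assms] invertible_left_inverse by blast
  have "transpose (matrix_inv W) ** (transpose W ** M ** W) ** matrix_inv W
      = transpose (W ** matrix_inv W) ** M ** (W ** matrix_inv W)"
    by (simp only: matrix_transpose_mul matrix_mul_assoc)
  also have "\<dots> = M"
    by (simp add: matrix_inv_mult[OF assms])
  finally show ?thesis
    using *[OF _ inv, of "transpose W ** M ** W"] *[OF _ assms, of M] by metis
qed

section \<open>The linear matrix inequalities as a Gramian inequality\<close>

lemma diag_mult_vector: "diag \<beta> *v v = (\<chi> i. \<beta> $ i * v $ i)"
  by (simp add: diag_def matrix_vector_mult_def if_distrib if_distribR cong: if_cong)

lemma diag_mult_diag: "diag \<beta> ** diag \<delta> = diag (\<chi> i. \<beta> $ i * \<delta> $ i)"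
  by (simp add: matrix_eq diag_mult_vector mult.assoc flip: matrix_vector_mul_assoc)

lemma transpose_diag [simp]: "transpose (diag \<beta>) = diag \<beta>"
  by (auto simp: diag_def transpose_def vec_eq_iff)

lemma pos_def_diag:
  fixes \<beta> :: "real^'n"
  assumes "\<And>i. 0 < \<beta> $ i"
  shows "pos_def (diag \<beta>)"
  unfolding pos_def_def
proof (intro conjI allI impI)
  fix v :: "real^'n" assume "v \<noteq> 0"
  then obtain i where i: "v $ i \<noteq> 0"
    by (auto simp: vec_eq_iff)
  have "v \<bullet> (diag \<beta> *v v) = (\<Sum>i\<in>UNIV. \<beta> $ i * (v $ i)\<^sup>2)"
    by (simp add: diag_mult_vector inner_vec_def power2_eq_square mult_ac)
  also have "\<dots> > 0"
    using i assms by (intro sum_pos2[of UNIV i]) (auto simp: less_imp_le[OF assms])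
  finally show "0 < v \<bullet> (diag \<beta> *v v)" .
qed simp

text \<open>The variables \<open>\<beta>\<close> enter the matrix inequality as the weight of the sensor block; its inverse is
  the covariance of the scaled sensor noise. This is why squared precisions make the problem
  linear.\<close>

lemma matrix_inv_diag_eq_noise_gram:
  assumes "\<And>i. 0 < \<beta> $ i"
  shows "matrix_inv (diag \<beta>) = Sn (\<chi> i. sqrt (\<beta> $ i)) ** transpose (Sn (\<chi> i. sqrt (\<beta> $ i)))"
proof (rule matrix_inv_unique)
  have "\<beta> $ i * (1 / sqrt (\<beta> $ i) * (1 / sqrt (\<beta> $ i))) = 1" for i
    using assms[of i] by simp
  then show "diag \<beta> ** (Sn (\<chi> i. sqrt (\<beta> $ i)) ** transpose (Sn (\<chi> i. sqrt (\<beta> $ i)))) = mat 1"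
    by (simp add: Sn_def diag_mult_diag) (simp add: diag_def mat_def vec_eq_iff)
qed

lemma matrix_inv_mat_1: "matrix_inv (mat 1 :: real^'n^'n) = mat 1"
  by (rule matrix_inv_unique) simp

lemma pos_def_mat_1: "pos_def (mat 1 :: real^'n^'n)"
  using pos_def_scaled_identity[of 1] by simp

text \<open>Congruence with \<open>W = X\<inverse>\<close> passes from the inequality in \<open>X\<close>, which is linear after the
  substitution \<open>Y = X L\<close>, to the one in the Gramian bound \<open>W\<close>.\<close>

lemma lyapunov_congruence:
  fixes X W F K :: "real^'n^'n"
  assumes "W ** X = mat 1" "X ** W = mat 1" "transpose X = X"
  shows "W ** (X ** F + transpose (X ** F) + X ** K ** X) ** W = F ** W + W ** transpose F + K"
proof -
  have [simp]: "M ** X ** W = M" "M ** W ** X = M" for M :: "real^'n^'n"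
    using assms by (simp_all flip: matrix_mul_assoc)
  show ?thesis
    by (simp add: matrix_add_ldistrib matrix_add_rdistrib matrix_transpose_mul matrix_mul_assoc assms)
qed

lemma lmi1_block_form:
  "lmi1 S X Y \<beta> \<rho> = vcat (hcat (M11 S X Y \<rho>) (hcat (M12 S X Y \<rho>) Y))
     (hcat (transpose (hcat (M12 S X Y \<rho>) Y)) (- vcat (hcat (mat 1) 0) (hcat 0 (diag \<beta>))))"
  by (simp add: lmi1_def uminus_vcat uminus_hcat hcat_vcat_interchange)

lemma err_B_hcat: "err_B S \<kappa> L \<rho> = hcat ((Bd S \<rho> + L ** Dd S \<rho>) ** Sd S) (L ** Sn \<kappa>)"
  by (simp add: err_B_def Bw_def Dw_def mult_hcat add_hcat matrix_add_rdistrib matrix_mul_assoc)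

text \<open>The lower right block of the first matrix inequality is \<open>- diag (1, \<beta>)\<close>. Its Schur complement
  replaces the disturbance and sensor columns by \<open>X B B\<^sup>T X\<close>, where \<open>B\<close> is the input matrix of the
  error system with gain \<open>L\<close> and precision \<open>\<kappa>\<close>.\<close>

lemma neg_def_lmi1_iff:
  assumes X: "pos_def X" and \<beta>: "\<And>i. 0 < \<beta> $ i"
  defines "W \<equiv> matrix_inv X" and "\<kappa> \<equiv> \<chi> i. sqrt (\<beta> $ i)"
  shows "neg_def (lmi1 S X (X ** L) \<beta> \<rho>) \<longleftrightarrow>
    neg_def (err_A S L \<rho> ** W + W ** transpose (err_A S L \<rho>)
      + err_B S \<kappa> L \<rho> ** transpose (err_B S \<kappa> L \<rho>))"
proof -
  let ?F = "err_A S L \<rho>"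
  define G where "G = (Bd S \<rho> + L ** Dd S \<rho>) ** Sd S"
  let ?K = "err_B S \<kappa> L \<rho> ** transpose (err_B S \<kappa> L \<rho>)"
  note invX = pos_def_imp_invertible[OF X]
  note inv\<beta> = pos_def_imp_invertible[OF pos_def_diag[OF \<beta>]]
  have symX: "transpose X = X" and symW: "transpose W = W"
    using X pos_def_matrix_inv[OF X] by (simp_all add: pos_def_def W_def)
  have WX: "W ** X = mat 1" "X ** W = mat 1"
    unfolding W_def by (rule matrix_inv_mult[OF invX])+
  have invW: "invertible W"
    using WX invertible_left_inverse by blast
  have M11: "M11 S X (X ** L) \<rho> = X ** ?F + transpose (X ** ?F)"
    by (simp add: M11_def err_A_def matrix_add_ldistrib matrix_mul_assoc)
  have M12: "M12 S X (X ** L) \<rho> = X ** G"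
    by (simp add: G_def M12_def matrix_add_ldistrib matrix_add_rdistrib matrix_mul_assoc)
  have K: "?K = G ** transpose G + L ** (Sn \<kappa> ** transpose (Sn \<kappa>)) ** transpose L"
    unfolding err_B_hcat hcat_gram G_def[symmetric] by (simp add: matrix_transpose_mul matrix_mul_assoc)
  have "neg_def (lmi1 S X (X ** L) \<beta> \<rho>) \<longleftrightarrow>
      neg_def (M11 S X (X ** L) \<rho> + (M12 S X (X ** L) \<rho> ** transpose (M12 S X (X ** L) \<rho>)
        + X ** L ** matrix_inv (diag \<beta>) ** transpose (X ** L)))"
    unfolding lmi1_block_form
    by (subst neg_def_schur_complement)
       (simp_all only: pos_def_block_diagonal pos_def_mat_1 pos_def_diag \<beta>
          matrix_inv_block_diagonal[OF pos_def_imp_invertible[OF pos_def_mat_1] inv\<beta>]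
          hcat_block_diagonal_congruence matrix_inv_mat_1 matrix_mul_rid)
  also have "M11 S X (X ** L) \<rho> + (M12 S X (X ** L) \<rho> ** transpose (M12 S X (X ** L) \<rho>)
        + X ** L ** matrix_inv (diag \<beta>) ** transpose (X ** L))
      = X ** ?F + transpose (X ** ?F) + X ** ?K ** X"
    unfolding M11 M12 K matrix_inv_diag_eq_noise_gram[OF \<beta>] \<kappa>_def[symmetric]
    by (simp add: matrix_add_ldistrib matrix_add_rdistrib matrix_transpose_mul matrix_mul_assoc symX)
  also have "neg_def \<dots> \<longleftrightarrow> neg_def (W ** (X ** ?F + transpose (X ** ?F) + X ** ?K ** X) ** W)"
    using neg_def_congruence[OF invW] by (simp add: symW)
  also have "W ** (X ** ?F + transpose (X ** ?F) + X ** ?K ** X) ** W = ?F ** W + W ** transpose ?F + ?K"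
    by (rule lyapunov_congruence[OF WX symX])
  finally show ?thesis .
qed

lemma neg_def_lmi2_iff:
  assumes "pos_def X"
  shows "neg_def (lmi2 S Q X \<rho>) \<longleftrightarrow> pos_def (Q - Cz S \<rho> ** matrix_inv X ** transpose (Cz S \<rho>))"
  unfolding lmi2_def neg_def_schur_complement[OF assms]
  by (simp add: neg_def_iff_pos_def_uminus algebra_simps)

lemma pos_def_of_schur_complement:
  fixes C :: "real^'n^'m"
  assumes W: "pos_def W" and Q: "pos_def (Q - C ** W ** transpose C)"
  shows "pos_def Q"
  unfolding pos_def_def
proof (intro conjI allI impI)
  have "transpose (C ** W ** transpose C) = C ** W ** transpose C"
    using W by (simp add: pos_def_def matrix_transpose_mul matrix_mul_assoc)
  then show "transpose Q = Q"
    using Q by (simp add: pos_def_def transpose_diff)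
  fix v :: "real^'m" assume v: "v \<noteq> 0"
  have "0 \<le> (v v* C) \<bullet> (W *v (v v* C))"
    using W unfolding pos_def_def by (cases "v v* C = 0") (auto intro: less_imp_le)
  moreover have "v \<bullet> ((C ** W ** transpose C) *v v) = (v v* C) \<bullet> (W *v (v v* C))"
    by (simp add: dot_lmul_matrix flip: matrix_vector_mul_assoc)
  moreover have "0 < v \<bullet> ((Q - C ** W ** transpose C) *v v)"
    using Q v by (simp add: pos_def_def)
  ultimately show "0 < v \<bullet> (Q *v v)"
    by (simp add: matrix_vector_mult_diff_rdistrib inner_diff_right)
qed

text \<open>Both sides are described by the same inequalities for \<open>W = X\<inverse>\<close>, with inverse substitutions
  \<open>(Y, X, \<beta>) \<mapsto> (X\<inverse> Y, X\<inverse>, \<surd>\<beta>)\<close> and \<open>(L, W, \<kappa>) \<mapsto> (W\<inverse> L, W\<inverse>, \<kappa>\<^sup>2)\<close>. Feasible points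
  have a positive definite \<open>Q\<close>; on the other side this follows from \<open>Q > C W C\<^sup>T\<close> at any parameter
  value.\<close>

lemma design_of_feasible_eq_quadratic_h2_designs:
  fixes S :: "('r::finite, 'x::finite, 'y::finite, 'z::finite, 'd::finite) lpv"
  assumes "0 < \<gamma>"
  shows "design_of ` feasible S P \<gamma> = quadratic_h2_designs S P \<gamma>"
proof (intro subset_antisym subsetI)
  fix d assume "d \<in> design_of ` feasible S P \<gamma>"
  then obtain Y Q X \<beta> where f: "(Y, Q, X, \<beta>) \<in> feasible S P \<gamma>" and "d = design_of (Y, Q, X, \<beta>)"
    by auto
  then have X: "pos_def X" and \<beta>: "\<And>i. 0 < \<beta> $ i" and tr: "trace Q < \<gamma>\<^sup>2"
    and lmi: "\<And>\<rho>. \<rho> \<in> P \<Longrightarrow> neg_def (lmi1 S X Y \<beta> \<rho>) \<and> neg_def (lmi2 S Q X \<rho>)"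
    and d: "d = (\<chi> i. sqrt (\<beta> $ i), matrix_inv X ** Y)"
    by (simp_all add: feasible_def design_of_def)
  define L where "L = matrix_inv X ** Y"
  have Y: "Y = X ** L"
    by (simp add: L_def matrix_mul_assoc matrix_inv_mult[OF pos_def_imp_invertible[OF X]])
  show "d \<in> quadratic_h2_designs S P \<gamma>"
    using \<beta> tr pos_def_matrix_inv[OF X] lmi[unfolded Y neg_def_lmi1_iff[OF X \<beta>] neg_def_lmi2_iff[OF X]]
    unfolding d quadratic_h2_designs_def L_def[symmetric] by auto
next
  fix d assume "d \<in> quadratic_h2_designs S P \<gamma>"
  then obtain \<kappa> L W Q where d: "d = (\<kappa>, L)" and \<kappa>: "\<And>i. 0 < \<kappa> $ i" and W: "pos_def W" and tr: "trace Q < \<gamma>\<^sup>2"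
    and ineq: "\<And>\<rho>. \<rho> \<in> P \<Longrightarrow> neg_def (err_A S L \<rho> ** W + W ** transpose (err_A S L \<rho>)
                          + err_B S \<kappa> L \<rho> ** transpose (err_B S \<kappa> L \<rho>)) \<and>
               pos_def (Q - Cz S \<rho> ** W ** transpose (Cz S \<rho>))"
    unfolding quadratic_h2_designs_def by blast
  define X where "X = matrix_inv W"
  define \<beta> where "\<beta> = (\<chi> i. (\<kappa> $ i)\<^sup>2)"
  have X: "pos_def X" and WX: "matrix_inv X = W"
    unfolding X_def by (rule pos_def_matrix_inv[OF W], rule matrix_inv_matrix_inv[OF pos_def_imp_invertible[OF W]])
  have \<beta>: "0 < \<beta> $ i" for i
    using \<kappa>[of i] by (simp add: \<beta>_def)
  have \<kappa>\<beta>: "(\<chi> i. sqrt (\<beta> $ i)) = \<kappa>"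
    using \<kappa> by (simp add: \<beta>_def vec_eq_iff less_imp_le)
  obtain Q' where Q': "pos_def Q'" "trace Q' < \<gamma>\<^sup>2"
    "\<And>\<rho>. \<rho> \<in> P \<Longrightarrow> pos_def (Q' - Cz S \<rho> ** W ** transpose (Cz S \<rho>))"
  proof (cases "P = {}")
    \<comment> \<open>Over the empty parameter set nothing relates \<open>Q\<close> to \<open>W\<close>, so \<open>Q\<close> need not be positive definite.\<close>
    case True
    define \<epsilon> where "\<epsilon> = \<gamma>\<^sup>2 / (2 * real CARD('z))"
    have "0 < \<epsilon>" "\<epsilon> * real CARD('z) < \<gamma>\<^sup>2"
      using assms by (simp_all add: \<epsilon>_def)
    then show ?thesis
      using that[of "\<epsilon> *\<^sub>R mat 1"] True by (simp add: pos_def_scaled_identity trace_scaleR trace_I)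
  next
    case False
    then have "pos_def Q"
      using pos_def_of_schur_complement[OF W] ineq by blast
    then show ?thesis
      using that[of Q] tr ineq by blast
  qed
  have "(X ** L, Q', X, \<beta>) \<in> feasible S P \<gamma>"
    unfolding feasible_def
    using X Q' \<beta> ineq by (simp add: neg_def_lmi1_iff[OF X \<beta>] neg_def_lmi2_iff[OF X] WX \<kappa>\<beta>)
  moreover have "design_of (X ** L, Q', X, \<beta>) = d"
    by (simp add: design_of_def d \<kappa>\<beta> matrix_mul_assoc matrix_inv_mult[OF pos_def_imp_invertible[OF X]])
  ultimately show "d \<in> design_of ` feasible S P \<gamma>"
    by (metis image_eqI)
qed

lemma quadratic_h2_designs_singleton:
  assumes "0 < \<gamma>"
  shows "quadratic_h2_designs S {\<rho>} \<gamma> = h2_designs S {\<rho>} \<gamma>"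
  unfolding quadratic_h2_designs_def h2_designs_def h2_performance_def transfer_fn_def
  by (simp add: h2_norm_less_iff_lyapunov_inequality[OF assms])

lemma h2_designs_pointwise:
  "(\<kappa>, L) \<in> h2_designs S P \<gamma> \<longleftrightarrow> (\<forall>i. 0 < \<kappa> $ i) \<and> (\<forall>\<rho>\<in>P. (\<kappa>, L) \<in> h2_designs S {\<rho>} \<gamma>)"
  by (auto simp: h2_designs_def h2_performance_def)

text \<open>A common Gramian bound serves each parameter value separately.\<close>

lemma quadratic_h2_designs_subset:
  assumes "0 < \<gamma>"
  shows "quadratic_h2_designs S P \<gamma> \<subseteq> h2_designs S P \<gamma>"
proof (intro subrelI)
  fix \<kappa> L assume d: "(\<kappa>, L) \<in> quadratic_h2_designs S P \<gamma>"
  then have "(\<kappa>, L) \<in> quadratic_h2_designs S {\<rho>} \<gamma>" if "\<rho> \<in> P" for \<rho>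
    using that unfolding quadratic_h2_designs_def by blast
  then show "(\<kappa>, L) \<in> h2_designs S P \<gamma>"
    using d unfolding h2_designs_pointwise[of \<kappa> L S P] quadratic_h2_designs_singleton[OF assms]
    by (simp add: quadratic_h2_designs_def)
qed

section \<open>Convexity\<close>

lemma pos_def_convex_combination:
  assumes "pos_def M" "pos_def N" "0 \<le> u" "0 \<le> v" "u + v = 1"
  shows "pos_def (u *\<^sub>R M + v *\<^sub>R N)"
  unfolding pos_def_def
proof (intro conjI allI impI)
  show "transpose (u *\<^sub>R M + v *\<^sub>R N) = u *\<^sub>R M + v *\<^sub>R N"
    using assms by (simp add: pos_def_def transpose_add transpose_scalar)
  fix x :: "real^'a" assume "x \<noteq> 0"
  then have "0 < x \<bullet> (M *v x)" "0 < x \<bullet> (N *v x)"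
    using assms by (simp_all add: pos_def_def)
  then have "0 < u * (x \<bullet> (M *v x)) + v * (x \<bullet> (N *v x))"
    using assms(3-5) by (cases "u = 0") (auto intro: add_pos_nonneg)
  then show "0 < x \<bullet> ((u *\<^sub>R M + v *\<^sub>R N) *v x)"
    by (simp add: matrix_vector_mult_add_rdistrib inner_add_right flip: scaleR_matrix_vector_assoc)
qed

lemma neg_def_convex_combination:
  assumes "neg_def M" "neg_def N" "0 \<le> u" "0 \<le> v" "u + v = 1"
  shows "neg_def (u *\<^sub>R M + v *\<^sub>R N)"
  using pos_def_convex_combination[of "- M" "- N" u v] assms by (simp add: neg_def_iff_pos_def_uminus)

lemma vcat_combination: "vcat (u *\<^sub>R M + v *\<^sub>R M') (u *\<^sub>R N + v *\<^sub>R N') = u *\<^sub>R vcat M N + v *\<^sub>R vcat M' N'"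
  for u v :: real
  by (simp add: vcat_def vec_eq_iff split: sum.split)

lemma hcat_combination: "hcat (u *\<^sub>R M + v *\<^sub>R M') (u *\<^sub>R N + v *\<^sub>R N') = u *\<^sub>R hcat M N + v *\<^sub>R hcat M' N'"
  for u v :: real
  by (simp add: hcat_def vec_eq_iff split: sum.split)

lemma convex_combination_self: "u + v = 1 \<Longrightarrow> u *\<^sub>R M + v *\<^sub>R M = M" for M :: "'a::real_vector"
  by (simp flip: scaleR_add_left)

text \<open>The matrix is affine, not linear, in the variables because of the constant block, hence the
  restriction to \<open>u + v = 1\<close>.\<close>

lemma lmi1_convex_combination:
  assumes "u + v = 1"
  shows "lmi1 S (u *\<^sub>R X + v *\<^sub>R X') (u *\<^sub>R Y + v *\<^sub>R Y') (u *\<^sub>R \<beta> + v *\<^sub>R \<beta>') \<rho>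
    = u *\<^sub>R lmi1 S X Y \<beta> \<rho> + v *\<^sub>R lmi1 S X' Y' \<beta>' \<rho>"
proof -
  have M11: "M11 S (u *\<^sub>R X + v *\<^sub>R X') (u *\<^sub>R Y + v *\<^sub>R Y') \<rho> = u *\<^sub>R M11 S X Y \<rho> + v *\<^sub>R M11 S X' Y' \<rho>"
    by (simp add: M11_def matrix_add_rdistrib transpose_add transpose_scalar algebra_simps flip: scalar_matrix_assoc)
  have M12: "M12 S (u *\<^sub>R X + v *\<^sub>R X') (u *\<^sub>R Y + v *\<^sub>R Y') \<rho> = u *\<^sub>R M12 S X Y \<rho> + v *\<^sub>R M12 S X' Y' \<rho>"
    by (simp add: M12_def matrix_add_rdistrib algebra_simps flip: scalar_matrix_assoc)
  have diag: "- diag (u *\<^sub>R \<beta> + v *\<^sub>R \<beta>') = u *\<^sub>R (- diag \<beta>) + v *\<^sub>R (- diag \<beta>')"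
    by (simp add: diag_def vec_eq_iff)
  have tr: "transpose (u *\<^sub>R M + v *\<^sub>R M') = u *\<^sub>R transpose M + v *\<^sub>R transpose M'" for M M' :: "real^'m^'n"
    by (simp add: transpose_add transpose_scalar)
  show ?thesis
    unfolding lmi1_def M11 M12 diag tr vcat_combination[symmetric] hcat_combination[symmetric]
      convex_combination_self[OF assms] ..
qed

lemma lmi2_combination:
  "lmi2 S (u *\<^sub>R Q + v *\<^sub>R Q') (u *\<^sub>R X + v *\<^sub>R X') \<rho> = u *\<^sub>R lmi2 S Q X \<rho> + v *\<^sub>R lmi2 S Q' X' \<rho>"
  if "u + v = 1"
  unfolding lmi2_def vcat_combination[symmetric] hcat_combination[symmetric]
    convex_combination_self[OF that] by simp

lemma convex_feasible: "convex (feasible S P \<gamma>)"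
  unfolding convex_def
proof (intro ballI allI impI)
  fix d d' and u v :: real
  assume d: "d \<in> feasible S P \<gamma>" "d' \<in> feasible S P \<gamma>" and uv: "0 \<le> u" "0 \<le> v" "u + v = 1"
  obtain Y Q X \<beta> where d_eq: "d = (Y, Q, X, \<beta>)"
    by (metis prod.exhaust)
  obtain Y' Q' X' \<beta>' where d'_eq: "d' = (Y', Q', X', \<beta>')"
    by (metis prod.exhaust)
  have comb: "u * a + v * b < c" if "a < c" "b < c" for a b c :: real
    using convex_bound_lt[OF that uv] .
  have "0 < u * \<beta> $ i + v * \<beta>' $ i" for i
    using comb[of "- \<beta> $ i" 0 "- \<beta>' $ i"] d by (simp add: d_eq d'_eq feasible_def)
  moreover have "trace (u *\<^sub>R Q + v *\<^sub>R Q') < \<gamma>\<^sup>2"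
    using comb[of "trace Q" "\<gamma>\<^sup>2" "trace Q'"] d
    by (simp add: d_eq d'_eq feasible_def trace_add trace_scaleR)
  ultimately show "u *\<^sub>R d + v *\<^sub>R d' \<in> feasible S P \<gamma>"
    using d uv unfolding d_eq d'_eq feasible_def
    by (auto simp: lmi1_convex_combination[OF uv(3)] lmi2_combination[OF uv(3)]
        intro!: pos_def_convex_combination neg_def_convex_combination)
qed

text \<open>Minkowski's inequality for positive entries. With \<open>s\<close> and \<open>t\<close> the two norms, \<open>(x + y) / (s + t)\<close>
  is the convex combination of the unit vectors \<open>x / s\<close> and \<open>y / t\<close> with weights proportional to
  \<open>s\<close> and \<open>t\<close>, and convexity of the \<open>q\<close>-th power bounds its norm by one.\<close>

lemma minkowski_sum_powr:
  fixes x y :: "'i \<Rightarrow> real"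
  assumes I: "finite I" "I \<noteq> {}" and q: "1 \<le> q" and pos: "\<And>i. i \<in> I \<Longrightarrow> 0 < x i" "\<And>i. i \<in> I \<Longrightarrow> 0 < y i"
  shows "(\<Sum>i\<in>I. (x i + y i) powr q) powr (1 / q)
    \<le> (\<Sum>i\<in>I. x i powr q) powr (1 / q) + (\<Sum>i\<in>I. y i powr q) powr (1 / q)"
proof -
  define s where "s = (\<Sum>i\<in>I. x i powr q) powr (1 / q)"
  define t where "t = (\<Sum>i\<in>I. y i powr q) powr (1 / q)"
  have sums: "0 < (\<Sum>i\<in>I. x i powr q)" "0 < (\<Sum>i\<in>I. y i powr q)"
    using I pos by (auto intro!: sum_pos simp: less_imp_neq[THEN not_sym])
  have s: "0 < s" "s powr q = (\<Sum>i\<in>I. x i powr q)"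
    using sums(1) q by (auto simp: s_def powr_powr)
  have t: "0 < t" "t powr q = (\<Sum>i\<in>I. y i powr q)"
    using sums(2) q by (auto simp: t_def powr_powr)
  define l where "l = t / (s + t)"
  have l: "0 \<le> l" "l \<le> 1" "1 - l = s / (s + t)"
    using s(1) t(1) by (auto simp: l_def field_simps)
  have "(x i + y i) powr q \<le> (s + t) powr q * ((1 - l) * (x i powr q / s powr q) + l * (y i powr q / t powr q))"
    if i: "i \<in> I" for i
  proof -
    have "x i + y i = (s + t) * ((1 - l) * (x i / s) + l * (y i / t))"
      unfolding l(3) using s(1) t(1) by (simp add: l_def distrib_left)
    then have "(x i + y i) powr q = (s + t) powr q * ((1 - l) * (x i / s) + l * (y i / t)) powr q"
      using s(1) t(1) l pos[OF i] by (simp add: powr_mult)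
    also have "((1 - l) * (x i / s) + l * (y i / t)) powr q \<le> (1 - l) * (x i / s) powr q + l * (y i / t) powr q"
      using convex_onD[OF powr_convex[OF q] l(1,2), of "x i / s" "y i / t"] s(1) t(1) pos[OF i] by simp
    finally show ?thesis
      using s(1) t(1) pos[OF i] by (simp add: powr_divide mult_left_mono)
  qed
  then have "(\<Sum>i\<in>I. (x i + y i) powr q)
      \<le> (\<Sum>i\<in>I. (s + t) powr q * ((1 - l) * (x i powr q / s powr q) + l * (y i powr q / t powr q)))"
    by (rule sum_mono)
  also have "\<dots> = (s + t) powr q * ((1 - l) * ((\<Sum>i\<in>I. x i powr q) / s powr q) + l * ((\<Sum>i\<in>I. y i powr q) / t powr q))"
    by (simp add: sum_distrib_left sum.distrib sum_divide_distrib distrib_left)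
  also have "\<dots> = (s + t) powr q"
    using s t sums by simp
  finally have "(\<Sum>i\<in>I. (x i + y i) powr q) powr (1 / q) \<le> ((s + t) powr q) powr (1 / q)"
    using q by (intro powr_mono2 sum_nonneg) auto
  also have "\<dots> = s + t"
    using s(1) t(1) q by (simp add: powr_powr)
  finally show ?thesis
    by (simp add: s_def t_def)
qed

lemma pnorm_add_le:
  fixes x y :: "real^'n"
  assumes "1 \<le> p" "\<And>i. 0 < x $ i" "\<And>i. 0 < y $ i"
  shows "pnorm p (x + y) \<le> pnorm p x + pnorm p y"
proof (cases "p = \<infinity>")
  case True
  then show ?thesis by (simp add: pnorm_def infnorm_triangle)
next
  case False
  then have "1 \<le> real_of_ereal p"
    using assms(1) by (cases p) auto
  from minkowski_sum_powr[OF _ _ this, of UNIV "\<lambda>i. x $ i" "\<lambda>i. y $ i"] show ?thesis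
    using False assms(2,3) by (simp add: pnorm_def abs_of_pos add_pos_pos)
qed

lemma pnorm_scaleR:
  fixes x :: "real^'n"
  assumes "1 \<le> p" "0 \<le> c"
  shows "pnorm p (c *\<^sub>R x) = c * pnorm p x"
proof (cases "p = \<infinity>")
  case True
  then show ?thesis using assms(2) by (simp add: pnorm_def infnorm_mul)
next
  case False
  then have "1 \<le> real_of_ereal p"
    using assms(1) by (cases p) auto
  then show ?thesis
    using False assms(2)
    by (simp add: pnorm_def abs_mult powr_mult sum_nonneg powr_powr flip: sum_distrib_left)
qed

lemma convex_on_objective:
  assumes "1 \<le> p"
  shows "convex_on (feasible S P \<gamma>) (objective p)"
proof (rule convex_onI[OF _ convex_feasible])
  fix t :: real and d d'
  assume t: "0 < t" "t < 1" and d: "d \<in> feasible S P \<gamma>" "d' \<in> feasible S P \<gamma>"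
  obtain Y Q X \<beta> where d_eq: "d = (Y, Q, X, \<beta>)"
    by (metis prod.exhaust)
  obtain Y' Q' X' \<beta>' where d'_eq: "d' = (Y', Q', X', \<beta>')"
    by (metis prod.exhaust)
  have "pnorm p ((1 - t) *\<^sub>R \<beta> + t *\<^sub>R \<beta>') \<le> pnorm p ((1 - t) *\<^sub>R \<beta>) + pnorm p (t *\<^sub>R \<beta>')"
    using t d by (intro pnorm_add_le assms) (auto simp: d_eq d'_eq feasible_def)
  then show "objective p ((1 - t) *\<^sub>R d + t *\<^sub>R d') \<le> (1 - t) * objective p d + t * objective p d'"
    using t by (simp add: d_eq d'_eq objective_def pnorm_scaleR[OF assms])
qed

section \<open>Optimal designs\<close>

lemma precision_cost_design_of:
  "d \<in> feasible S P \<gamma> \<Longrightarrow> precision_cost p (design_of d) = objective p d"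
  by (auto simp: feasible_def precision_cost_def design_of_def objective_def less_imp_le)

text \<open>A cost-preserving parametrization of the set of designs carries minimizers and optimal values
  along.\<close>

lemma solves_viaI:
  assumes image: "\<phi> ` F = D" and cost: "\<And>v. v \<in> F \<Longrightarrow> c (\<phi> v) = f v"
  shows "solves_via \<phi> f F c D"
proof -
  have "\<phi> ` argmins f F = argmins c D"
  proof (intro subset_antisym subsetI)
    fix d assume "d \<in> \<phi> ` argmins f F"
    then show "d \<in> argmins c D"
      by (auto simp: argmins_def is_arg_min_def cost simp flip: image)
  next
    fix d assume d: "d \<in> argmins c D"
    then obtain v where "v \<in> F" "d = \<phi> v"
      by (auto simp: argmins_def is_arg_min_def simp flip: image)
    moreover from this have "v \<in> argmins f F"
      using d by (auto simp: argmins_def is_arg_min_def cost simp flip: image)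
    ultimately show "d \<in> \<phi> ` argmins f F"
      by blast
  qed
  moreover have "opt_value f F = opt_value c D"
    unfolding opt_value_def image[symmetric] image_image by (intro INF_cong) (simp_all add: cost)
  ultimately show ?thesis
    using image cost by (simp add: solves_via_def)
qed

theorem theorem1:
  fixes S :: "('r::finite, 'x::finite, 'y::finite, 'z::finite, 'd::finite) lpv"
    and P :: "(real^'r) set" and \<gamma> :: real and p :: ereal
  assumes "polytope P" and "0 < \<gamma>" and "1 \<le> p"
  shows "convex (feasible S P \<gamma>) \<and> convex_on (feasible S P \<gamma>) (objective p) \<and>
    design_of ` feasible S P \<gamma> \<subseteq> h2_designs S P \<gamma> \<and>
    opt_value (precision_cost p) (h2_designs S P \<gamma>) \<le> opt_value (objective p) (feasible S P \<gamma>) \<and>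
    solves_via design_of (objective p) (feasible S P \<gamma>)
      (precision_cost p) (quadratic_h2_designs S P \<gamma>) \<and>
    (\<forall>\<rho>. P = {\<rho>} \<longrightarrow>
      solves_via design_of (objective p) (feasible S P \<gamma>) (precision_cost p) (h2_designs S P \<gamma>)) \<and>
    h2_designs S P \<gamma> = {(\<kappa>, L). (\<forall>i. 0 < \<kappa> $ i) \<and>
      (\<forall>\<rho>\<in>P. (\<kappa>, L) \<in> design_of ` feasible S {\<rho>} \<gamma>)}"
proof (intro conjI allI impI)
  note image = design_of_feasible_eq_quadratic_h2_designs[OF assms(2)]
  show "convex (feasible S P \<gamma>)"
    by (rule convex_feasible)
  show "convex_on (feasible S P \<gamma>) (objective p)"
    by (rule convex_on_objective[OF assms(3)])
  show sub: "design_of ` feasible S P \<gamma> \<subseteq> h2_designs S P \<gamma>"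
    unfolding image by (rule quadratic_h2_designs_subset[OF assms(2)])
  show via: "solves_via design_of (objective p) (feasible S P \<gamma>)
      (precision_cost p) (quadratic_h2_designs S P \<gamma>)"
    by (rule solves_viaI[OF image], rule precision_cost_design_of)
  have "opt_value (precision_cost p) (h2_designs S P \<gamma>)
      \<le> opt_value (precision_cost p) (quadratic_h2_designs S P \<gamma>)"
    unfolding opt_value_def by (rule INF_superset_mono[OF quadratic_h2_designs_subset[OF assms(2)]]) simp
  then show "opt_value (precision_cost p) (h2_designs S P \<gamma>) \<le> opt_value (objective p) (feasible S P \<gamma>)"
    using via by (simp add: solves_via_def)
  show "solves_via design_of (objective p) (feasible S P \<gamma>) (precision_cost p) (h2_designs S P \<gamma>)"
    if "P = {\<rho>}" for \<rho>
    using via unfolding that quadratic_h2_designs_singleton[OF assms(2)] .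
  show "h2_designs S P \<gamma> = {(\<kappa>, L). (\<forall>i. 0 < \<kappa> $ i) \<and>
      (\<forall>\<rho>\<in>P. (\<kappa>, L) \<in> design_of ` feasible S {\<rho>} \<gamma>)}"
    unfolding image[of S "{_}"] quadratic_h2_designs_singleton[OF assms(2)]
    using h2_designs_pointwise[of _ _ S P] by auto
qed

end
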